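(* Let $K$ be a field with $\mathrm{char}(K)=0$ or $\mathrm{char}(K)>4$. Let $R=K[x_{\{i,j\}}\mid 1\le i<j\le 4]$ be the polynomial algebra in six variables, with $S_4$ acting by $K$-algebra automorphisms via $\sigma\cdot x_{\{i,j\}}=x_{\{\sigma(i),\sigma(j)\}}$. Let $x_1,x_2,x_3,z_1,z_2,z_3\in R$, the elements $[x^az^b]\in R$, the polynomial algebra $\mathcal{F}$, and the elements $J_{3,2},J_{2,3},J_{4,2},J_{3,3},J_{2,4}\in\mathcal{F}$ be as defined in the context. (i) The algebra $R^{S_4}$ is generated by the ten elements $$[x],\ [x^2],\ [x^3],\ [z^2],\ [z^4],\ [z^6],\ [xz^2],\ [x^2z^2],\ [xz^4],\ z_1z_2z_3.$$ (ii) Consider the surjective $K$-algebra homomorphism $\phi:\mathcal{F}\to R^{S_4}$ given by $\phi(S)=z_1z_2z_3$ and $\phi(T_{x^ay^b})=[x^az^{2b}]$ for $x^ay^b\in\{x,x^2,x^3,y,y^2,y^3,xy,x^2y,xy^2\}$. The kernel of $\phi$ is minimally generated (as an ideal) by the element $$S^2-\tfrac13T_{y^3}+\tfrac12T_{y^2}T_y-\tfrac16T_y^3$$ and the five elements $J_{3,2},\ J_{2,3},\ J_{4,2},\ J_{3,3},\ J_{2,4}$.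
   Context: In $R$ set $$x_1=x_{\{1,2\}}+x_{\{3,4\}},\quad x_2=x_{\{1,3\}}+x_{\{2,4\}},\quad x_3=x_{\{1,4\}}+x_{\{2,3\}},$$ $$z_1=x_{\{1,2\}}-x_{\{3,4\}},\quad z_2=x_{\{1,3\}}-x_{\{2,4\}},\quad z_3=x_{\{1,4\}}-x_{\{2,3\}},$$ and $[x^az^b]:=x_1^az_1^b+x_2^az_2^b+x_3^az_3^b$ (so $[x]=x_1+x_2+x_3$, $[z^2]=z_1^2+z_2^2+z_3^2$, $[xz^2]=x_1z_1^2+x_2z_2^2+x_3z_3^2$, etc.). $R^{S_4}$ is the subalgebra of $S_4$-invariants. $\mathcal{F}=K[T_w,S\mid w\in\{x,x^2,x^3,y,y^2,y^3,xy,x^2y,xy^2\}]$ is the commutative polynomial algebra in ten indeterminates (the subscripts $w$ are monomials in $K[x,y]$). The elements $J_{i,j}\in\mathcal{F}$ are: \begin{align*} J_{3,2}&=6T_{x^2y}T_{xy}-3T_{xy^2}T_{x^2}-2T_{x^2y}T_{x}T_{y}+T_{xy^2}T_{x}^2-4T_{xy}^2T_{x}+2T_{xy}T_{x}^2T_{y}\\ &\quad-3T_{x^3}T_{y^2}+4T_{x^2}T_{x}T_{y^2}-T_{x}^3T_{y^2}+T_{x^3}T_{y}^2-T_{x^2}T_{x}T_{y}^2, \end{align*} \begin{align*} J_{2,3}&=6T_{xy^2}T_{xy}-3T_{x^2y}T_{y^2}-2T_{xy^2}T_{x}T_{y}+T_{x^2y}T_{y}^2-4T_{xy}^2T_{y}+2T_{xy}T_{y}^2T_{x}\\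 &\quad-3T_{y^3}T_{x^2}+4T_{y^2}T_{y}T_{x^2}-T_{y}^3T_{x^2}+T_{y^3}T_{x}^2-T_{y^2}T_{y}T_{x}^2, \end{align*} \begin{align*} J_{4,2}&=6T_{x^2y}^2+T_{xy}^2T_{x^2}-3T_{xy}^2T_{x}^2-6T_{x^3}T_{xy^2}+2T_{x^2}T_{xy^2}T_{x}+4T_{x^3}T_{xy}T_{y}\\ &\quad-2T_{x^2}T_{xy}T_{x}T_{y}+2T_{xy}T_{x}^3T_{y}-4T_{x^2y}T_{x^2}T_{y}-T_{x^2}^2T_{y^2}+T_{x^2}^2T_{y}^2\\ &\quad+4T_{x^2}T_{x}^2T_{y^2}-T_{x^2}T_{x}^2T_{y}^2-T_{x}^4T_{y^2}-2T_{x^3}T_{x}T_{y^2}, \end{align*} \begin{align*} J_{3,3}&=3T_{x^2y}T_{xy^2}-T_{xy}T_{x^2}T_{y^2}+T_{xy}^3+T_{xy}T_x^2T_{y^2}-5T_{xy}^2T_xT_y-3T_{x^3}T_{y^3}\\ &\quad+2T_{xy}T_{xy^2}T_x+T_{x^2}T_xT_{y^3}-3T_{x^2}T_{xy^2}T_y+2T_{x^2y}T_{xy}T_y+3T_{x^2}T_xT_{y^2}T_y\\ &\quad+T_{x^3}T_{y^2}T_y+T_{x^2}T_{xy}T_y^2-T_x^3T_{y^2}T_y+2T_x^2T_{xy}T_y^2-T_{x^2}T_xT_y^3-3T_xT_{x^2y}T_{y^2}, \end{align*} \begin{align*} J_{2,4}&=6T_{xy^2}^2+T_{xy}^2T_{y^2}-3T_{xy}^2T_{y}^2-6T_{y^3}T_{x^2y}+2T_{y^2}T_{x^2y}T_{y}+4T_{y^3}T_{xy}T_{x}\\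 &\quad-2T_{y^2}T_{xy}T_{x}T_{y}+2T_{xy}T_{y}^3T_{x}-4T_{xy^2}T_{y^2}T_{x}-T_{y^2}^2T_{x^2}+T_{y^2}^2T_{x}^2\\ &\quad+4T_{y^2}T_{y}^2T_{x^2}-T_{y^2}T_{y}^2T_{x}^2-T_{y}^4T_{x^2}-2T_{y^3}T_{y}T_{x^2}. \end{align*} "Minimally generated" means that the listed elements generate and no proper subset of them does. *)

theory Defs
  imports HOL.Modules "HOL-Library.Poly_Mapping" "HOL-Combinatorics.Permutations"
begin

section \<open>Polynomial algebras and algebra homomorphisms\<close>

text \<open>The polynomial algebra \<open>K[v | v :: 'v]\<close>, as the monoid algebra over \<open>'a\<close> of the
  free commutative monoid on \<open>'v\<close>.\<close>

type_synonym ('v, 'a) polyalg = "('v \<Rightarrow>\<^sub>0 nat) \<Rightarrow>\<^sub>0 'a"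

definition Const :: "'a::comm_ring_1 \<Rightarrow> ('v, 'a) polyalg"
  where "Const c = Poly_Mapping.single 0 c"

definition Var :: "'v \<Rightarrow> ('v, 'a::comm_ring_1) polyalg"
  where "Var v = Poly_Mapping.single (Poly_Mapping.single v 1) 1"

definition alg_hom :: "(('v, 'a::comm_ring_1) polyalg \<Rightarrow> ('w, 'a) polyalg) \<Rightarrow> bool"
  where "alg_hom \<theta> \<longleftrightarrow>
    (\<forall>p q. \<theta> (p + q) = \<theta> p + \<theta> q) \<and>
    (\<forall>p q. \<theta> (p * q) = \<theta> p * \<theta> q) \<and>
    (\<forall>c. \<theta> (Const c) = Const c)"

text \<open>Substitution of the elements \<open>f v\<close> for the variables \<open>v\<close>; the lemmas \<open>alg_hom_subst\<close>,
  \<open>subst_Var\<close> and \<open>alg_hom_unique\<close> below show that this is the unique algebra homomorphism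
  with the prescribed values on the variables.\<close>

definition subst :: "('v \<Rightarrow> ('w, 'a::comm_ring_1) polyalg) \<Rightarrow> ('v, 'a) polyalg \<Rightarrow> ('w, 'a) polyalg"
  where "subst f p = (\<Sum>m\<in>Poly_Mapping.keys p. Const (Poly_Mapping.lookup p m) *
    (\<Prod>v\<in>Poly_Mapping.keys m. f v ^ Poly_Mapping.lookup m v))"

definition subalgebra :: "('v, 'a::comm_ring_1) polyalg set \<Rightarrow> bool"
  where "subalgebra A \<longleftrightarrow>
    range Const \<subseteq> A \<and> (\<forall>p\<in>A. \<forall>q\<in>A. p + q \<in> A) \<and> (\<forall>p\<in>A. \<forall>q\<in>A. p * q \<in> A)"

definition alg_generated :: "('v, 'a::comm_ring_1) polyalg set \<Rightarrow> ('v, 'a) polyalg set"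
  where "alg_generated B = subalgebra hull B"

text \<open>Ideals are the submodules of a commutative ring regarded as a module over itself.\<close>

definition ideal_generated :: "'r::comm_ring_1 set \<Rightarrow> 'r set"
  where "ideal_generated B = module.span (*) B"

definition minimally_generated_ideal :: "'r::comm_ring_1 set \<Rightarrow> 'r set \<Rightarrow> bool"
  where "minimally_generated_ideal I B \<longleftrightarrow>
    ideal_generated B = I \<and> (\<forall>C. C \<subset> B \<longrightarrow> ideal_generated C \<noteq> I)"

lemma module_mult: "module ((*) :: 'r::comm_ring_1 \<Rightarrow> 'r \<Rightarrow> 'r)"
  by unfold_locales (simp_all add: algebra_simps)

lemma Const_add: "Const (a + b) = Const a + Const b"
  by (simp add: Const_def single_add)

lemma Const_mult: "Const (a * b) = Const a * Const b"
  by (simp add: Const_def mult_single)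

lemma Const_0 [simp]: "Const 0 = 0"
  by (simp add: Const_def)

lemma Const_1 [simp]: "Const 1 = 1"
  by (simp add: Const_def)

lemma subst_superset:
  assumes "finite A" "Poly_Mapping.keys p \<subseteq> A"
  shows "subst f p = (\<Sum>m\<in>A. Const (Poly_Mapping.lookup p m) *
    (\<Prod>v\<in>Poly_Mapping.keys m. f v ^ Poly_Mapping.lookup m v))"
  unfolding subst_def using assms
  by (intro sum.mono_neutral_left) (auto simp: in_keys_iff)

lemma prod_keys_superset:
  fixes f :: "'v \<Rightarrow> 'r::comm_ring_1"
  assumes "finite A" "Poly_Mapping.keys m \<subseteq> A"
  shows "(\<Prod>v\<in>Poly_Mapping.keys m. f v ^ Poly_Mapping.lookup m v) =
    (\<Prod>v\<in>A. f v ^ Poly_Mapping.lookup m v)"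
  using assms by (intro prod.mono_neutral_left) (auto simp: in_keys_iff)

lemma prod_keys_add:
  fixes f :: "'v \<Rightarrow> 'r::comm_ring_1"
  shows "(\<Prod>v\<in>Poly_Mapping.keys (m + n). f v ^ Poly_Mapping.lookup (m + n) v) =
    (\<Prod>v\<in>Poly_Mapping.keys m. f v ^ Poly_Mapping.lookup m v) *
    (\<Prod>v\<in>Poly_Mapping.keys n. f v ^ Poly_Mapping.lookup n v)"
proof -
  let ?A = "Poly_Mapping.keys m \<union> Poly_Mapping.keys n"
  have "(\<Prod>v\<in>Poly_Mapping.keys k. f v ^ Poly_Mapping.lookup k v) =
      (\<Prod>v\<in>?A. f v ^ Poly_Mapping.lookup k v)" if "Poly_Mapping.keys k \<subseteq> ?A" for k
    by (rule prod_keys_superset) (use that in auto)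
  from this[of "m + n"] this[of m] this[of n] show ?thesis
    using Poly_Mapping.keys_add[of m n] by (simp add: lookup_add power_add prod.distrib)
qed

lemma subst_add: "subst f (p + q) = subst f p + subst f q"
proof -
  let ?A = "Poly_Mapping.keys p \<union> Poly_Mapping.keys q"
  have "Poly_Mapping.keys (p + q) \<subseteq> ?A"
    by (rule Poly_Mapping.keys_add)
  then show ?thesis
    by (simp add: subst_superset[of ?A] lookup_add Const_add algebra_simps sum.distrib)
qed

lemma subst_zero [simp]: "subst f 0 = 0"
  by (simp add: subst_def)

lemma subst_single:
  "subst f (Poly_Mapping.single m c) =
    Const c * (\<Prod>v\<in>Poly_Mapping.keys m. f v ^ Poly_Mapping.lookup m v)"
  by (subst subst_superset[of "{m}"]) auto

lemma polyalg_induct [case_names zero add]: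
  fixes p :: "('v, 'a::comm_ring_1) polyalg"
  assumes "P 0"
    and "\<And>p m c. P p \<Longrightarrow> P (p + Poly_Mapping.single m c)"
  shows "P p"
proof (induction p rule: update_induct)
  case const
  then show ?case by (rule assms(1))
next
  case (update p m c)
  then have "Poly_Mapping.update m c p = p + Poly_Mapping.single m c"
    by (intro poly_mapping_eqI) (auto simp: lookup_update lookup_add lookup_single in_keys_iff when_def)
  then show ?case using assms(2) update by simp
qed

lemma subst_mult: "subst f (p * q) = subst f p * subst f q"
proof (induction p rule: polyalg_induct)
  case (add p m c)
  have "subst f (Poly_Mapping.single m c * q) = subst f (Poly_Mapping.single m c) * subst f q"
    by (induction q rule: polyalg_induct)
      (simp_all add: distrib_left subst_add mult_single subst_single prod_keys_add Const_mult ac_simps)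
  with add show ?case by (simp add: distrib_right subst_add)
qed simp

lemma subst_Const: "subst f (Const c) = Const c"
  by (simp add: Const_def subst_single[of f 0 c, unfolded Const_def])

lemma subst_Var [simp]: "subst f (Var v) = f v"
  by (simp add: Var_def subst_single)

lemma alg_hom_subst: "alg_hom (subst f)"
  by (simp add: alg_hom_def subst_add subst_mult subst_Const)

lemma single_eq_Var_prod:
  fixes c :: "'a::comm_ring_1" and m :: "'v \<Rightarrow>\<^sub>0 nat"
  shows "Poly_Mapping.single m c =
    Const c * (\<Prod>v\<in>Poly_Mapping.keys m. Var v ^ Poly_Mapping.lookup m v)"
proof -
  have pow: "Var v ^ k = Poly_Mapping.single (Poly_Mapping.single v k) (1::'a)" for v :: 'v and k
    by (induction k) (simp_all add: Var_def mult_single single_add[symmetric])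
  have "(\<Prod>v\<in>A. Var v ^ Poly_Mapping.lookup m v) =
      Poly_Mapping.single (\<Sum>v\<in>A. Poly_Mapping.single v (Poly_Mapping.lookup m v)) (1::'a)"
    if "finite A" for A :: "'v set"
    using that by induction (simp_all add: pow mult_single)
  moreover have "(\<Sum>v\<in>Poly_Mapping.keys m. Poly_Mapping.single v (Poly_Mapping.lookup m v)) = m"
    by (intro poly_mapping_eqI)
      (auto simp: lookup_sum lookup_single when_def in_keys_iff)
  ultimately show ?thesis by (simp add: Const_def mult_single)
qed

lemma alg_hom_unique:
  assumes "alg_hom \<theta>"
  shows "\<theta> = subst (\<lambda>v. \<theta> (Var v))"
proof
  fix p
  have add: "\<theta> (p + q) = \<theta> p + \<theta> q" and mult: "\<theta> (p * q) = \<theta> p * \<theta> q"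
    and const: "\<theta> (Const c) = Const c" for p q c
    using assms by (auto simp: alg_hom_def)
  have zero: "\<theta> 0 = 0" and one: "\<theta> 1 = 1"
    using const[of 0] const[of 1] by simp_all
  have power: "\<theta> (p ^ k) = \<theta> p ^ k" for p and k :: nat
    by (induction k) (simp_all add: one mult)
  have prod: "\<theta> (\<Prod>v\<in>A. Var v ^ e v) = (\<Prod>v\<in>A. \<theta> (Var v) ^ e v)" for A and e :: "_ \<Rightarrow> nat"
    by (induction A rule: infinite_finite_induct) (simp_all add: one mult power)
  show "\<theta> p = subst (\<lambda>v. \<theta> (Var v)) p"
  proof (induction p rule: polyalg_induct)
    case (add p m c)
    have "\<theta> (Poly_Mapping.single m c) = subst (\<lambda>v. \<theta> (Var v)) (Poly_Mapping.single m c)"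
      by (subst single_eq_Var_prod) (simp add: mult const prod subst_single)
    with add show ?case by (simp add: \<open>\<And>p q. \<theta> (p + q) = \<theta> p + \<theta> q\<close> subst_add)
  qed (simp add: zero)
qed

section \<open>The algebra \<open>R\<close> and its invariants\<close>

typedef edge = "{e :: nat set. e \<subseteq> {1..4} \<and> card e = 2}"
  by (intro exI[of _ "{1,2}"]) auto

definition edge_map :: "(nat \<Rightarrow> nat) \<Rightarrow> edge \<Rightarrow> edge"
  where "edge_map \<sigma> e = Abs_edge (\<sigma> ` Rep_edge e)"

definition perm_act :: "(nat \<Rightarrow> nat) \<Rightarrow> (edge, 'a::field) polyalg \<Rightarrow> (edge, 'a) polyalg"
  where "perm_act \<sigma> = subst (\<lambda>e. Var (edge_map \<sigma> e))"

definition S4_invariants :: "(edge, 'a::field) polyalg set"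
  where "S4_invariants = {p. \<forall>\<sigma>. \<sigma> permutes {1..4} \<longrightarrow> perm_act \<sigma> p = p}"

definition xe :: "nat \<Rightarrow> nat \<Rightarrow> (edge, 'a::field) polyalg"
  where "xe i j = Var (Abs_edge {i, j})"

lemma perm_act_xe:
  assumes "\<sigma> permutes {1..4}" "i \<in> {1..4}" "j \<in> {1..4}" "i \<noteq> j"
  shows "perm_act \<sigma> (xe i j) = xe (\<sigma> i) (\<sigma> j)"
proof -
  have "Rep_edge (Abs_edge {i, j}) = {i, j}"
    by (rule Abs_edge_inverse) (use assms in auto)
  then show ?thesis
    by (simp add: perm_act_def xe_def edge_map_def)
qed

definition "x1 = xe 1 2 + xe 3 4"
definition "x2 = xe 1 3 + xe 2 4"
definition "x3 = xe 1 4 + xe 2 3"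
definition "z1 = xe 1 2 - xe 3 4"
definition "z2 = xe 1 3 - xe 2 4"
definition "z3 = xe 1 4 - xe 2 3"

text \<open>\<open>br a b\<close> is the element \<open>[x\<^sup>az\<^sup>b]\<close>.\<close>

definition br :: "nat \<Rightarrow> nat \<Rightarrow> (edge, 'a::field) polyalg"
  where "br a b = x1 ^ a * z1 ^ b + x2 ^ a * z2 ^ b + x3 ^ a * z3 ^ b"

section \<open>The algebra \<open>F\<close> and the map \<open>\<phi>\<close>\<close>

text \<open>The variables of \<open>F\<close>: for instance \<open>Tx2y\<close> stands for the indeterminate whose
  subscript is the monomial \<open>x\<^sup>2y\<close>.\<close>

datatype indet = Tx | Tx2 | Tx3 | Ty | Ty2 | Ty3 | Txy | Tx2y | Txy2 | S

fun phi_indet :: "indet \<Rightarrow> (edge, 'a::field) polyalg" where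
  "phi_indet Tx   = br 1 0"
| "phi_indet Tx2  = br 2 0"
| "phi_indet Tx3  = br 3 0"
| "phi_indet Ty   = br 0 2"
| "phi_indet Ty2  = br 0 4"
| "phi_indet Ty3  = br 0 6"
| "phi_indet Txy  = br 1 2"
| "phi_indet Tx2y = br 2 2"
| "phi_indet Txy2 = br 1 4"
| "phi_indet S    = z1 * z2 * z3"

definition phi :: "(indet, 'a::field) polyalg \<Rightarrow> (edge, 'a) polyalg"
  where "phi = subst phi_indet"

lemma alg_hom_phi: "alg_hom phi"
  by (simp add: phi_def alg_hom_subst)

lemma phi_Var: "phi (Var v) = phi_indet v"
  by (simp add: phi_def)

abbreviation t :: "indet \<Rightarrow> (indet, 'a::field) polyalg"
  where "t \<equiv> Var"

definition rel_S :: "(indet, 'a::field) polyalg"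
  where "rel_S = t S ^ 2 - Const (1 / 3) * t Ty3 + Const (1 / 2) * t Ty2 * t Ty
    - Const (1 / 6) * t Ty ^ 3"

definition J32 :: "(indet, 'a::field) polyalg"
  where "J32 = 6 * t Tx2y * t Txy - 3 * t Txy2 * t Tx2 - 2 * t Tx2y * t Tx * t Ty
    + t Txy2 * t Tx^2 - 4 * t Txy^2 * t Tx + 2 * t Txy * t Tx^2 * t Ty
    - 3 * t Tx3 * t Ty2 + 4 * t Tx2 * t Tx * t Ty2 - t Tx^3 * t Ty2
    + t Tx3 * t Ty^2 - t Tx2 * t Tx * t Ty^2"

definition J23 :: "(indet, 'a::field) polyalg"
  where "J23 = 6 * t Txy2 * t Txy - 3 * t Tx2y * t Ty2 - 2 * t Txy2 * t Tx * t Ty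
    + t Tx2y * t Ty^2 - 4 * t Txy^2 * t Ty + 2 * t Txy * t Ty^2 * t Tx
    - 3 * t Ty3 * t Tx2 + 4 * t Ty2 * t Ty * t Tx2 - t Ty^3 * t Tx2
    + t Ty3 * t Tx^2 - t Ty2 * t Ty * t Tx^2"

definition J42 :: "(indet, 'a::field) polyalg"
  where "J42 = 6 * t Tx2y^2 + t Txy^2 * t Tx2 - 3 * t Txy^2 * t Tx^2 - 6 * t Tx3 * t Txy2
    + 2 * t Tx2 * t Txy2 * t Tx + 4 * t Tx3 * t Txy * t Ty - 2 * t Tx2 * t Txy * t Tx * t Ty
    + 2 * t Txy * t Tx^3 * t Ty - 4 * t Tx2y * t Tx2 * t Ty - t Tx2^2 * t Ty2
    + t Tx2^2 * t Ty^2 + 4 * t Tx2 * t Tx^2 * t Ty2 - t Tx2 * t Tx^2 * t Ty^2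
    - t Tx^4 * t Ty2 - 2 * t Tx3 * t Tx * t Ty2"

definition J33 :: "(indet, 'a::field) polyalg"
  where "J33 = 3 * t Tx2y * t Txy2 - t Txy * t Tx2 * t Ty2 + t Txy^3 + t Txy * t Tx^2 * t Ty2
    - 5 * t Txy^2 * t Tx * t Ty - 3 * t Tx3 * t Ty3 + 2 * t Txy * t Txy2 * t Tx
    + t Tx2 * t Tx * t Ty3 - 3 * t Tx2 * t Txy2 * t Ty + 2 * t Tx2y * t Txy * t Ty
    + 3 * t Tx2 * t Tx * t Ty2 * t Ty + t Tx3 * t Ty2 * t Ty + t Tx2 * t Txy * t Ty^2
    - t Tx^3 * t Ty2 * t Ty + 2 * t Tx^2 * t Txy * t Ty^2 - t Tx2 * t Tx * t Ty^3
    - 3 * t Tx * t Tx2y * t Ty2"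

definition J24 :: "(indet, 'a::field) polyalg"
  where "J24 = 6 * t Txy2^2 + t Txy^2 * t Ty2 - 3 * t Txy^2 * t Ty^2 - 6 * t Ty3 * t Tx2y
    + 2 * t Ty2 * t Tx2y * t Ty + 4 * t Ty3 * t Txy * t Tx - 2 * t Ty2 * t Txy * t Tx * t Ty
    + 2 * t Txy * t Ty^3 * t Tx - 4 * t Txy2 * t Ty2 * t Tx - t Ty2^2 * t Tx2
    + t Ty2^2 * t Tx^2 + 4 * t Ty2 * t Ty^2 * t Tx2 - t Ty2 * t Ty^2 * t Tx^2
    - t Ty^4 * t Tx2 - 2 * t Ty3 * t Ty * t Tx2"

end

theory Submission
  imports "HOL-Algebra.Algebraic_Closure_Type" Defs
begin

text \<open>
  Put \<open>y\<^sub>i = z\<^sub>i\<^sup>2\<close>. Each permutation in \<open>S\<^sub>4\<close> permutes the three pairs \<open>(x\<^sub>i, z\<^sub>i)\<close> up to signs of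
  the \<open>z\<^sub>i\<close> with product \<open>1\<close>; the Klein four-group fixes the \<open>x\<^sub>i\<close> and makes all even sign changes.
  Since 2 is invertible, the \<open>x\<^sub>i\<close> and \<open>z\<^sub>i\<close> are coordinates of \<open>R\<close>, and the invariants are
  \<open>A \<oplus> z\<^sub>1z\<^sub>2z\<^sub>3 A\<close>, where \<open>A = K[x\<^sub>i, y\<^sub>i]\<^bsup>S\<^sub>3\<^esup>\<close> is the algebra of multisymmetric polynomials in
  the three points \<open>(x\<^sub>i, y\<^sub>i)\<close>.

  Generation. As 24 is invertible, every invariant is a linear combination of averages of monomials
  (\<open>S3_klein_sum_invariant\<close>). The average of a monomial is zero or, up to a power of
  \<open>z\<^sub>1z\<^sub>2z\<^sub>3\<close>, a symmetrised product of three monomials in the points, and such a product is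
  a polynomial in the power sums \<open>[x\<^sup>ay\<^sup>b]\<close> (\<open>S3_klein_sum_in_range_phi\<close>). As there
  are only three points, the sum of the products of four monomials at four different points is
  empty; expanded by inclusion and exclusion, this expresses \<open>[x\<^sup>ay\<^sup>b]\<close> with \<open>a + b \<ge> 4\<close> by
  power sums of smaller degree (\<open>power_sum_in_range_phi\<close>).

  Kernel. Let \<open>P\<close> be the subalgebra of \<open>\<F>\<close> generated by the six indeterminates whose
  subscript is a power of \<open>x\<close> or of \<open>y\<close>, and write \<open>u\<close>, \<open>v\<close>, \<open>w\<close> for the indeterminates with
  subscripts \<open>xy\<close>, \<open>x\<^sup>2y\<close>, \<open>xy\<^sup>2\<close>. Modulo the six relations
  every element of \<open>\<F>\<close> is a \<open>P\<close>-linear combination of \<open>1, u, v, w, u\<^sup>2, u\<^sup>3\<close> and of \<open>S\<close> times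
  these (\<open>normal_form_exists\<close>): the five \<open>J\<close> rewrite \<open>uv\<close>, \<open>uw\<close>, \<open>v\<^sup>2\<close>, \<open>vw\<close> and
  \<open>w\<^sup>2\<close>, the remaining product \<open>u\<^sup>4\<close> is reached by rewriting \<open>uvw\<close> in two ways, and the sixth
  relation rewrites \<open>S\<^sup>2\<close>.
  It remains to see that the images of these twelve elements are linearly independent over
  the image of \<open>P\<close>, and that \<open>\<phi>\<close> is injective on \<open>P\<close>
  (\<open>normal_form_kernel_trivial\<close>). Both follow from evaluation over an algebraically closed
  extension field. The six indeterminates of \<open>P\<close> can be given arbitrary values, because these
  prescribe the power sums of the roots \<open>X\<^sub>i\<close> and \<open>Y\<^sub>i\<close> of two cubic polynomials. Permuting the
  \<open>Y\<^sub>i\<close> against the \<open>X\<^sub>i\<close>, and changing the sign of one square root of a \<open>Y\<^sub>i\<close>, does not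
  change the values of the elements of \<open>P\<close>. A combination that vanishes at the resulting twelve points
  has vanishing coefficients there as soon as the \<open>X\<^sub>i\<close> are distinct and the \<open>Y\<^sub>i\<close> are
  distinct and nonzero (\<open>orbit_value_nonsingular\<close>). This holds for generic values, so
  the coefficients are zero.

  Minimality. For each of the six generators there is a point at which it is nonzero and
  the five others vanish.
\<close>

section \<open>Evaluation of polynomials at geometric points\<close>

lemma numerals_nonzero:
  assumes "(2 :: 'b::idom) \<noteq> 0" "(3 :: 'b) \<noteq> 0"
  shows "(6 :: 'b) \<noteq> 0" "(9 :: 'b) \<noteq> 0" "(24 :: 'b) \<noteq> 0"
proof -
  have "(2 :: 'b) * 3 \<noteq> 0" "(3 :: 'b) * 3 \<noteq> 0" "(2 :: 'b) * (2 * (2 * 3)) \<noteq> 0"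
    using assms by (simp_all only: mult_eq_0_iff simp_thms)
  then show "(6 :: 'b) \<noteq> 0" "(9 :: 'b) \<noteq> 0" "(24 :: 'b) \<noteq> 0" by simp_all
qed

lemma alg_closure_numeral_nonzero:
  assumes "(numeral n :: 'a::field) \<noteq> 0"
  shows "(numeral n :: 'a alg_closure) \<noteq> 0"
  using assms to_ac_eq_0_iff[of "numeral n :: 'a"] by simp

text \<open>The monomials are reached from \<open>1\<close> by multiplication with variables, so a linear subspace
  that is stable under these multiplications is everything.\<close>

lemma polyalg_span_induct [case_names one add scale var]:
  fixes p :: "('v, 'a::comm_ring_1) polyalg"
  assumes one: "P 1"
    and add: "\<And>p q. P p \<Longrightarrow> P q \<Longrightarrow> P (p + q)"
    and scale: "\<And>c p. P p \<Longrightarrow> P (Const c * p)"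
    and var: "\<And>v p. P p \<Longrightarrow> P (Var v * p)"
  shows "P p"
proof (induction p rule: polyalg_induct)
  case zero
  show ?case using scale[OF one, of 0] by simp
next
  case (add p m c)
  have power: "P (Var v ^ k * q)" if "P q" for v k q
    using that by (induction k) (auto simp: mult.assoc intro: var)
  have "P (\<Prod>v\<in>A. Var v ^ Poly_Mapping.lookup m v)" for A
    by (induction A rule: infinite_finite_induct) (auto intro: one power)
  then have "P (Poly_Mapping.single m c)"
    by (subst single_eq_Var_prod) (rule scale)
  with add.IH show ?case by (rule assms(2))
qed

text \<open>Values of polynomials over \<open>K\<close> are taken in an algebraic closure: cubic equations have to be
  solved, and \<open>K\<close> itself may be finite.\<close>

definition aeval :: "('v \<Rightarrow> 'a alg_closure) \<Rightarrow> ('v, 'a::field) polyalg \<Rightarrow> 'a alg_closure"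
  where "aeval f p = (\<Sum>m\<in>Poly_Mapping.keys p. to_ac (Poly_Mapping.lookup p m) *
    (\<Prod>v\<in>Poly_Mapping.keys m. f v ^ Poly_Mapping.lookup m v))"

lemma aeval_superset:
  assumes "finite A" "Poly_Mapping.keys p \<subseteq> A"
  shows "aeval f p = (\<Sum>m\<in>A. to_ac (Poly_Mapping.lookup p m) *
    (\<Prod>v\<in>Poly_Mapping.keys m. f v ^ Poly_Mapping.lookup m v))"
  unfolding aeval_def using assms
  by (intro sum.mono_neutral_left) (auto simp: in_keys_iff)

lemma aeval_single:
  "aeval f (Poly_Mapping.single m c) =
    to_ac c * (\<Prod>v\<in>Poly_Mapping.keys m. f v ^ Poly_Mapping.lookup m v)"
  by (subst aeval_superset[of "{m}"]) auto

lemma aeval_zero [simp]: "aeval f 0 = 0"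
  by (simp add: aeval_def)

lemma aeval_Const [simp]: "aeval f (Const c) = to_ac c"
  by (simp add: Const_def aeval_single)

lemma aeval_one [simp]: "aeval f 1 = 1"
  using aeval_Const[of f 1] by simp

lemma aeval_Var [simp]: "aeval f (Var v) = f v"
  by (simp add: Var_def aeval_single)

lemma aeval_add [simp]: "aeval f (p + q) = aeval f p + aeval f q"
proof -
  let ?A = "Poly_Mapping.keys p \<union> Poly_Mapping.keys q"
  have "Poly_Mapping.keys (p + q) \<subseteq> ?A"
    by (rule Poly_Mapping.keys_add)
  then show ?thesis
    by (simp add: aeval_superset[of ?A] lookup_add algebra_simps sum.distrib)
qed

lemma aeval_mult [simp]: "aeval f (p * q) = aeval f p * aeval f q"
proof (induction p rule: polyalg_induct)
  case (add p m c)
  have "aeval f (Poly_Mapping.single m c * q) = aeval f (Poly_Mapping.single m c) * aeval f q"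
    by (induction q rule: polyalg_induct)
      (simp_all add: distrib_left mult_single aeval_single prod_keys_add ac_simps)
  with add show ?case by (simp add: distrib_right)
qed simp

lemma aeval_uminus [simp]: "aeval f (- p) = - aeval f p"
  using aeval_add[of f p "- p"] by (simp add: eq_neg_iff_add_eq_0 add.commute)

lemma aeval_diff [simp]: "aeval f (p - q) = aeval f p - aeval f q"
  using aeval_add[of f p "- q"] by simp

lemma aeval_power [simp]: "aeval f (p ^ k) = aeval f p ^ k"
  by (induction k) simp_all

lemma aeval_numeral [simp]: "aeval f (numeral n) = numeral n"
proof -
  have "aeval f (of_nat k) = of_nat k" for k
    by (induction k) simp_all
  from this[of "numeral n"] show ?thesis by simp
qed

lemma aeval_sum: "aeval f (\<Sum>x\<in>A. p x) = (\<Sum>x\<in>A. aeval f (p x))"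
  by (induction A rule: infinite_finite_induct) simp_all

lemma aeval_subst: "aeval f (subst g p) = aeval (\<lambda>v. aeval f (g v)) p"
  by (induction p rule: polyalg_span_induct)
    (simp_all add: subst_add subst_mult subst_Const subst_Const[of _ 1, simplified])

section \<open>Polynomials are determined by their values\<close>

lemma infinite_alg_closed: "infinite (UNIV :: 'b::alg_closed_field set)"
proof
  assume fin: "finite (UNIV :: 'b set)"
  \<comment> \<open>This polynomial takes the value 1 everywhere, but is not constant.\<close>
  define p where "p = (\<Prod>a\<in>UNIV. [:- a, 1::'b:]) + 1"
  have "poly p x = 1" for x
    using fin by (auto simp: p_def poly_prod)
  moreover have "\<exists>x. poly p x = 0"
  proof (rule alg_closed_imp_poly_has_root)
    have deg: "degree (\<Prod>a\<in>UNIV. [:- a, 1::'b:]) = card (UNIV :: 'b set)"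
      by (subst degree_prod_sum_eq) auto
    moreover have "0 < card (UNIV :: 'b set)" using fin by (simp add: card_gt_0_iff)
    ultimately show "0 < degree p" by (simp add: p_def degree_add_eq_left)
  qed
  ultimately show False by simp
qed

definition poly_vars :: "('v, 'a::comm_ring_1) polyalg \<Rightarrow> 'v set"
  where "poly_vars p = (\<Union>m\<in>Poly_Mapping.keys p. Poly_Mapping.keys m)"

lemma finite_poly_vars: "finite (poly_vars p)"
  by (simp add: poly_vars_def)

lemma aeval_cong:
  assumes "\<And>v. v \<in> poly_vars p \<Longrightarrow> f v = g v"
  shows "aeval f p = aeval g p"
  unfolding aeval_def
  by (intro sum.cong prod.cong arg_cong2[of _ _ _ _ "(*)"] refl) (use assms in \<open>force simp: poly_vars_def\<close>)

lemma poly_vars_single: "poly_vars (Poly_Mapping.single m c) \<subseteq> Poly_Mapping.keys m"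
  by (simp add: poly_vars_def)

lemma poly_vars_add: "poly_vars (p + q) \<subseteq> poly_vars p \<union> poly_vars q"
  using Poly_Mapping.keys_add[of p q] by (auto simp: poly_vars_def)

lemma poly_vars_sum: "poly_vars (\<Sum>x\<in>A. p x) \<subseteq> (\<Union>x\<in>A. poly_vars (p x))"
proof (induction A rule: infinite_finite_induct)
  case (insert a A)
  then show ?case using poly_vars_add[of "p a" "sum p A"] by auto
qed (auto simp: poly_vars_def)

lemma poly_vars_mult: "poly_vars (p * q) \<subseteq> poly_vars p \<union> poly_vars q"
proof
  fix v assume "v \<in> poly_vars (p * q)"
  then obtain m where m: "m \<in> Poly_Mapping.keys (p * q)" "v \<in> Poly_Mapping.keys m"
    by (auto simp: poly_vars_def)
  then obtain a b where "m = a + b" "a \<in> Poly_Mapping.keys p" "b \<in> Poly_Mapping.keys q"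
    using keys_mult[of p q] by auto
  with m Poly_Mapping.keys_add[of a b] show "v \<in> poly_vars p \<union> poly_vars q"
    by (auto simp: poly_vars_def)
qed

lemma poly_vars_Const [simp]: "poly_vars (Const c) = {}"
  by (auto simp: poly_vars_def Const_def)

lemma sum_single: "(\<Sum>m\<in>Poly_Mapping.keys p. Poly_Mapping.single m (Poly_Mapping.lookup p m)) = p"
  by (intro poly_mapping_eqI) (auto simp: lookup_sum lookup_single when_def in_keys_iff)

lemma Var_power: "Var v ^ k = Poly_Mapping.single (Poly_Mapping.single v k) (1::'a::comm_ring_1)"
  by (induction k) (simp_all add: Var_def mult_single single_add[symmetric])

text \<open>Expansion by powers of \<open>v\<close>. The coefficients keep the type of polynomials in all
  variables, as the induction over the variables does not change the type.\<close>

lemma poly_in_one_variable: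
  fixes p :: "('v, 'a::comm_ring_1) polyalg"
  obtains n d where "p = (\<Sum>k\<le>n. Var v ^ k * d k)" "\<And>k. poly_vars (d k) \<subseteq> poly_vars p - {v}"
proof -
  define rest where "rest m = m - Poly_Mapping.single v (Poly_Mapping.lookup m v)" for m :: "'v \<Rightarrow>\<^sub>0 nat"
  define d where "d k = (\<Sum>m | m \<in> Poly_Mapping.keys p \<and> Poly_Mapping.lookup m v = k.
    Poly_Mapping.single (rest m) (Poly_Mapping.lookup p m))" for k
  define n where "n = Max ((\<lambda>m. Poly_Mapping.lookup m v) ` Poly_Mapping.keys p)"
  have rest: "Poly_Mapping.keys (rest m) = Poly_Mapping.keys m - {v}" for m
    by (auto simp: rest_def in_keys_iff lookup_minus lookup_single when_def split: if_splits)
  have split: "Poly_Mapping.single m c = Var v ^ Poly_Mapping.lookup m v * Poly_Mapping.single (rest m) c"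
    for m and c :: 'a
  proof -
    have "Poly_Mapping.single v (Poly_Mapping.lookup m v) + rest m = m"
      by (intro poly_mapping_eqI) (auto simp: rest_def lookup_add lookup_minus lookup_single when_def)
    then show ?thesis by (simp add: Var_power mult_single)
  qed
  have "p = (\<Sum>m\<in>Poly_Mapping.keys p. Poly_Mapping.single m (Poly_Mapping.lookup p m))"
    by (rule sum_single[symmetric])
  also have "\<dots> = (\<Sum>k\<in>{..n}. \<Sum>m | m \<in> Poly_Mapping.keys p \<and> Poly_Mapping.lookup m v = k.
      Poly_Mapping.single m (Poly_Mapping.lookup p m))"
    by (rule sum.group[symmetric]) (auto simp: n_def)
  also have "\<dots> = (\<Sum>k\<in>{..n}. Var v ^ k * d k)"
    unfolding d_def sum_distrib_left
    by (intro sum.cong refl) (simp, metis split)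
  finally have "p = (\<Sum>k\<le>n. Var v ^ k * d k)" .
  moreover have "poly_vars (d k) \<subseteq> poly_vars p - {v}" for k
  proof -
    have "poly_vars (d k) \<subseteq> (\<Union>m\<in>{m \<in> Poly_Mapping.keys p. Poly_Mapping.lookup m v = k}. Poly_Mapping.keys (rest m))"
      unfolding d_def by (rule order.trans[OF poly_vars_sum]) (intro UN_mono subset_refl poly_vars_single)
    then show ?thesis by (auto simp: rest poly_vars_def)
  qed
  ultimately show ?thesis by (rule that)
qed

text \<open>\<open>generic vs P f\<close> says that \<open>P\<close> holds for almost all values of the last variable in \<open>vs\<close>,
  then for almost all values of the one before it, and so on, all other variables being
  set as in \<open>f\<close>. Almost all means all but finitely many. The exceptional values of a
  variable may thus depend on the variables behind it in the list. This weak form of Zariski density is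
  stable under conjunction, and the exceptional set can be described one variable at a time.\<close>

primrec generic :: "'v list \<Rightarrow> (('v \<Rightarrow> 'b) \<Rightarrow> bool) \<Rightarrow> ('v \<Rightarrow> 'b) \<Rightarrow> bool" where
  "generic [] P f = P f"
| "generic (v # vs) P f = generic vs (\<lambda>g. \<forall>\<^sub>F a in cofinite. P (g(v := a))) f"

lemma generic_mono: "generic vs P f \<Longrightarrow> (\<And>g. P g \<Longrightarrow> Q g) \<Longrightarrow> generic vs Q f"
proof (induction vs arbitrary: P Q)
  case (Cons v vs)
  from Cons.prems(1) have "generic vs (\<lambda>g. \<forall>\<^sub>F a in cofinite. P (g(v := a))) f" by simp
  then have "generic vs (\<lambda>g. \<forall>\<^sub>F a in cofinite. Q (g(v := a))) f"
    by (rule Cons.IH) (erule eventually_mono, erule Cons.prems(2))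
  then show ?case by simp
qed simp

lemma generic_conj: "generic vs P f \<Longrightarrow> generic vs Q f \<Longrightarrow> generic vs (\<lambda>g. P g \<and> Q g) f"
proof (induction vs arbitrary: P Q)
  case (Cons v vs)
  from Cons.prems have "generic vs (\<lambda>g. (\<forall>\<^sub>F a in cofinite. P (g(v := a))) \<and> (\<forall>\<^sub>F a in cofinite. Q (g(v := a)))) f"
    using Cons.IH[of "\<lambda>g. \<forall>\<^sub>F a in cofinite. P (g(v := a))" "\<lambda>g. \<forall>\<^sub>F a in cofinite. Q (g(v := a))"]
    by (simp only: generic.simps)
  then have "generic vs (\<lambda>g. \<forall>\<^sub>F a in cofinite. P (g(v := a)) \<and> Q (g(v := a))) f"
    by (rule generic_mono) (auto intro: eventually_conj)
  then show ?case by simp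
qed simp

lemma generic_ex:
  assumes "infinite (UNIV :: 'b set)"
  shows "generic vs P (f :: 'v \<Rightarrow> 'b) \<Longrightarrow> \<exists>g. P g"
proof (induction vs arbitrary: P)
  case (Cons v vs)
  then have "\<exists>g. \<forall>\<^sub>F a in cofinite. P (g(v := a))" using Cons.IH[of "\<lambda>g. \<forall>\<^sub>F a in cofinite. P (g(v := a))"]
    by (simp only: generic.simps)
  then obtain g where "finite {a. \<not> P (g(v := a))}" by (auto simp: eventually_cofinite)
  with assms have "{a. \<not> P (g(v := a))} \<noteq> UNIV" by metis
  then show ?case by blast
qed auto

text \<open>By induction on the variables: as a polynomial in the first variable, \<open>p\<close> has a nonzero
  coefficient, whose value is generically nonzero, and then only finitely many values of
  the first variable are roots.\<close>

lemma generic_nonzero: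
  fixes p :: "('v, 'a::field) polyalg"
  assumes "p \<noteq> 0" "poly_vars p \<subseteq> set vs"
  shows "generic vs (\<lambda>g. aeval g p \<noteq> 0) f"
  using assms
proof (induction vs arbitrary: p)
  case Nil
  have "Poly_Mapping.keys p = {0}"
  proof -
    have "Poly_Mapping.keys p \<subseteq> {0}" using Nil.prems by (auto simp: poly_vars_def)
    with Nil.prems(1) show ?thesis by (simp add: subset_singleton_iff)
  qed
  then show ?case by (simp add: aeval_def in_keys_iff[symmetric])
next
  case (Cons v vs)
  obtain d n where p: "p = (\<Sum>k\<le>n. Var v ^ k * d k)" and d: "\<And>k. poly_vars (d k) \<subseteq> poly_vars p - {v}"
    by (rule poly_in_one_variable[of p v]) (rule that)
  obtain k where k: "k \<le> n" "d k \<noteq> 0"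
  proof -
    have "p = 0" if "\<forall>k\<le>n. d k = 0"
      unfolding p using that by (intro sum.neutral) simp
    with Cons.prems(1) have "\<exists>k\<le>n. d k \<noteq> 0" by blast
    then show ?thesis using that by blast
  qed
  have "generic vs (\<lambda>g. aeval g (d k) \<noteq> 0) f"
    using Cons.prems(2) d[of k] by (intro Cons.IH k) auto
  moreover have "\<forall>\<^sub>F a in cofinite. aeval (g(v := a)) p \<noteq> 0" if g: "aeval g (d k) \<noteq> 0" for g
  proof -
    define q where "q = (\<Sum>i\<le>n. monom (aeval g (d i)) i)"
    have "coeff q k \<noteq> 0"
      using k g by (simp add: q_def coeff_sum)
    then have "q \<noteq> 0" by auto
    moreover have "aeval (g(v := a)) p = poly q a" for a
    proof -
      have "aeval (g(v := a)) (d i) = aeval g (d i)" for i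
        using d[of i] by (intro aeval_cong) auto
      then show ?thesis
        unfolding p q_def by (simp add: aeval_sum poly_sum poly_monom mult.commute)
    qed
    ultimately show ?thesis using poly_roots_finite[of q] by (simp add: eventually_cofinite)
  qed
  ultimately have "generic vs (\<lambda>g. \<forall>\<^sub>F a in cofinite. aeval (g(v := a)) p \<noteq> 0) f"
    by (rule generic_mono)
  then show ?case by simp
qed

text \<open>This transfers polynomial identities from the algebraic closure, an integral domain in
  which they are decided by Groebner bases, to the polynomial algebras.\<close>

lemma polyalg_eqI_aeval:
  fixes p q :: "('v, 'a::field) polyalg"
  assumes "\<And>f. aeval f p = aeval f q"
  shows "p = q"
proof (rule ccontr)
  assume "p \<noteq> q"
  then have "p - q \<noteq> 0" by simp
  moreover obtain vs where "set vs = poly_vars (p - q)"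
    using finite_list[OF finite_poly_vars] by metis
  ultimately have "generic vs (\<lambda>g. aeval g (p - q) \<noteq> 0) (\<lambda>_. 0)"
    by (intro generic_nonzero) auto
  then have "\<exists>g. aeval g (p - q) \<noteq> 0" by (rule generic_ex[OF infinite_alg_closed])
  with assms show False by simp
qed

section \<open>The action of the symmetric group on the coordinates\<close>

lemma subst_one: "subst f 1 = 1"
  using subst_Const[of f 1] by simp

lemma subst_diff: "subst f (p - q) = subst f p - subst f q"
  using subst_add[of f "p - q" q] by simp

lemma subst_power: "subst f (p ^ k) = subst f p ^ k"
  by (induction k) (simp_all add: subst_mult subst_one)

lemma subst_numeral: "subst f (numeral n) = numeral n"
proof -
  have "subst f (of_nat k) = of_nat k" for k
    by (induction k) (simp_all add: subst_add subst_one)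
  from this[of "numeral n"] show ?thesis by simp
qed

lemma xe_commute: "xe i j = xe j i"
  by (simp add: xe_def insert_commute)

lemma perm_act_hom:
  "perm_act \<sigma> (p + q) = perm_act \<sigma> p + perm_act \<sigma> q"
  "perm_act \<sigma> (p - q) = perm_act \<sigma> p - perm_act \<sigma> q"
  "perm_act \<sigma> (p * q) = perm_act \<sigma> p * perm_act \<sigma> q"
  "perm_act \<sigma> (p ^ k) = perm_act \<sigma> p ^ k"
  "perm_act \<sigma> (Const c) = Const c"
  "perm_act \<sigma> 1 = 1"
  "perm_act \<sigma> 0 = 0"
  "perm_act \<sigma> (numeral n) = numeral n"
  by (simp_all add: perm_act_def subst_add subst_diff subst_mult subst_power subst_Const subst_one subst_numeral)

lemmas xz_defs = x1_def x2_def x3_def z1_def z2_def z3_def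

lemma edge_map_comp:
  assumes "\<sigma> permutes {1..4}" "\<tau> permutes {1..4}"
  shows "edge_map (\<sigma> \<circ> \<tau>) e = edge_map \<sigma> (edge_map \<tau> e)"
proof -
  have "\<tau> ` Rep_edge e \<subseteq> {1..4}" "card (\<tau> ` Rep_edge e) = 2"
    using Rep_edge[of e] permutes_image[OF assms(2)] card_image[OF permutes_inj_on[OF assms(2)], of "Rep_edge e"]
    by auto
  then show ?thesis
    by (simp add: edge_map_def Abs_edge_inverse image_comp)
qed

lemma perm_act_comp:
  assumes "\<sigma> permutes {1..4}" "\<tau> permutes {1..4}"
  shows "perm_act (\<sigma> \<circ> \<tau>) p = perm_act \<sigma> (perm_act \<tau> p)"
  unfolding perm_act_def
  by (induction p rule: polyalg_span_induct)
    (simp_all add: subst_add subst_mult subst_Const subst_one edge_map_comp[OF assms] del: o_apply)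

lemma perm_act_id: "perm_act id p = p"
  unfolding perm_act_def edge_map_def
  by (induction p rule: polyalg_span_induct)
    (simp_all add: subst_add subst_mult subst_Const subst_one Rep_edge_inverse)

text \<open>Transpositions generate the symmetric group.\<close>

lemma S4_invariants_transposeI:
  assumes "perm_act (Transposition.transpose 1 2) p = p" "perm_act (Transposition.transpose 1 3) p = p"
    "perm_act (Transposition.transpose 1 4) p = p" "perm_act (Transposition.transpose 2 3) p = p"
    "perm_act (Transposition.transpose 2 4) p = p" "perm_act (Transposition.transpose 3 4) p = p"
  shows "p \<in> S4_invariants"
proof -
  have *: "perm_act (Transposition.transpose i j) p = p"
    if "i \<in> {1..4}" "j \<in> {1..4}" "i \<noteq> j" for i j
  proof -
    have "{1..4::nat} = {1,2,3,4}" by auto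
    with that assms show ?thesis
      by (auto simp: transpose_commute simp del: One_nat_def)
  qed
  have "perm_act \<sigma> p = p" if "\<sigma> permutes {1..4}" for \<sigma>
    using that finite_atLeastAtMost[of 1 "4::nat"]
  proof (induction rule: permutes_induct)
    case id
    show ?case by (rule perm_act_id)
  next
    case (swap a b \<tau>)
    then show ?case
      by (simp add: perm_act_comp * permutes_swap_id del: o_apply)
  qed
  then show ?thesis by (simp add: S4_invariants_def)
qed

lemma perm_act_transpose_xe:
  assumes "a \<in> {1..4}" "b \<in> {1..4}" "i \<in> {1..4}" "j \<in> {1..4}" "i \<noteq> j"
  shows "perm_act (Transposition.transpose a b) (xe i j) =
    xe (Transposition.transpose a b i) (Transposition.transpose a b j)"
  by (rule perm_act_xe) (use assms in \<open>auto intro: permutes_swap_id\<close>)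

lemma perm_act_12:
  "perm_act (Transposition.transpose 1 2) x1 = x1" "perm_act (Transposition.transpose 1 2) x2 = x3"
  "perm_act (Transposition.transpose 1 2) x3 = x2" "perm_act (Transposition.transpose 1 2) z1 = z1"
  "perm_act (Transposition.transpose 1 2) z2 = - z3" "perm_act (Transposition.transpose 1 2) z3 = - z2"
  by (simp_all add: xz_defs perm_act_hom perm_act_transpose_xe Transposition.transpose_def xe_commute[of 2 1] del: One_nat_def)

lemma perm_act_13:
  "perm_act (Transposition.transpose 1 3) x1 = x3" "perm_act (Transposition.transpose 1 3) x2 = x2"
  "perm_act (Transposition.transpose 1 3) x3 = x1" "perm_act (Transposition.transpose 1 3) z1 = - z3"
  "perm_act (Transposition.transpose 1 3) z2 = z2" "perm_act (Transposition.transpose 1 3) z3 = - z1"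
  by (simp_all add: xz_defs perm_act_hom perm_act_transpose_xe Transposition.transpose_def
      xe_commute[of 3 2] xe_commute[of 3 1] xe_commute[of 2 1] xe_commute[of 4 1] del: One_nat_def)

lemma perm_act_14:
  "perm_act (Transposition.transpose 1 4) x1 = x2" "perm_act (Transposition.transpose 1 4) x2 = x1"
  "perm_act (Transposition.transpose 1 4) x3 = x3" "perm_act (Transposition.transpose 1 4) z1 = - z2"
  "perm_act (Transposition.transpose 1 4) z2 = - z1" "perm_act (Transposition.transpose 1 4) z3 = z3"
  by (simp_all add: xz_defs perm_act_hom perm_act_transpose_xe Transposition.transpose_def
      xe_commute[of 4 2] xe_commute[of 3 1] xe_commute[of 4 1] xe_commute[of 4 3] xe_commute[of 2 1] del: One_nat_def)

lemma perm_act_23: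
  "perm_act (Transposition.transpose 2 3) x1 = x2" "perm_act (Transposition.transpose 2 3) x2 = x1"
  "perm_act (Transposition.transpose 2 3) x3 = x3" "perm_act (Transposition.transpose 2 3) z1 = z2"
  "perm_act (Transposition.transpose 2 3) z2 = z1" "perm_act (Transposition.transpose 2 3) z3 = z3"
  by (simp_all add: xz_defs perm_act_hom perm_act_transpose_xe Transposition.transpose_def
      xe_commute[of 3 2] del: One_nat_def)

lemma perm_act_24:
  "perm_act (Transposition.transpose 2 4) x1 = x3" "perm_act (Transposition.transpose 2 4) x2 = x2"
  "perm_act (Transposition.transpose 2 4) x3 = x1" "perm_act (Transposition.transpose 2 4) z1 = z3"
  "perm_act (Transposition.transpose 2 4) z2 = z2" "perm_act (Transposition.transpose 2 4) z3 = z1"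
  by (simp_all add: xz_defs perm_act_hom perm_act_transpose_xe Transposition.transpose_def
      xe_commute[of 4 2] xe_commute[of 4 3] xe_commute[of 3 2] del: One_nat_def)

lemma perm_act_34:
  "perm_act (Transposition.transpose 3 4) x1 = x1" "perm_act (Transposition.transpose 3 4) x2 = x3"
  "perm_act (Transposition.transpose 3 4) x3 = x2" "perm_act (Transposition.transpose 3 4) z1 = z1"
  "perm_act (Transposition.transpose 3 4) z2 = z3" "perm_act (Transposition.transpose 3 4) z3 = z2"
  by (simp_all add: xz_defs perm_act_hom perm_act_transpose_xe Transposition.transpose_def
      xe_commute[of 4 3] del: One_nat_def)

lemmas perm_act_xz = perm_act_12 perm_act_13 perm_act_14 perm_act_23 perm_act_24 perm_act_34

lemma br_even_invariant:
  assumes "even b"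
  shows "br a b \<in> S4_invariants"
  by (rule S4_invariants_transposeI)
    (use assms in \<open>simp_all add: br_def perm_act_hom perm_act_xz del: One_nat_def\<close>)

lemma z123_invariant: "z1 * z2 * z3 \<in> S4_invariants"
  by (rule S4_invariants_transposeI) (simp_all add: perm_act_hom perm_act_xz del: One_nat_def)

lemma phi_indet_invariant: "phi_indet v \<in> S4_invariants"
  by (cases v) (auto intro: br_even_invariant z123_invariant)

lemma subalgebra_S4_invariants: "Defs.subalgebra (S4_invariants :: (edge, 'a::field) polyalg set)"
  by (auto simp: Defs.subalgebra_def S4_invariants_def perm_act_hom)

definition invariant_generators :: "(edge, 'a::field) polyalg set"
  where "invariant_generators =
    {br 1 0, br 2 0, br 3 0, br 0 2, br 0 4, br 0 6, br 1 2, br 2 2, br 1 4, z1 * z2 * z3}"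

lemma invariant_generators_eq:
  "invariant_generators = range (phi_indet :: indet \<Rightarrow> (edge, 'a::field) polyalg)"
proof -
  have "UNIV = {Tx, Tx2, Tx3, Ty, Ty2, Ty3, Txy, Tx2y, Txy2, S}"
    using indet.exhaust by auto
  then have "range (phi_indet :: indet \<Rightarrow> (edge, 'a) polyalg) = phi_indet ` {Tx, Tx2, Tx3, Ty, Ty2, Ty3, Txy, Tx2y, Txy2, S}"
    by (rule arg_cong)
  then show ?thesis by (simp add: invariant_generators_def)
qed

lemma subalgebra_alg_generated: "Defs.subalgebra (alg_generated B)"
  unfolding alg_generated_def
  by (rule hull_in) (simp add: Defs.subalgebra_def subset_iff)

lemma alg_generated_superset: "B \<subseteq> alg_generated B"
  unfolding alg_generated_def by (rule hull_subset)

lemma range_phi_subset_alg_generated: "range phi \<subseteq> alg_generated (invariant_generators)"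
proof -
  let ?A = "alg_generated invariant_generators :: (edge, 'a) polyalg set"
  have A: "Const c \<in> ?A" "p \<in> ?A \<Longrightarrow> q \<in> ?A \<Longrightarrow> p + q \<in> ?A" "p \<in> ?A \<Longrightarrow> q \<in> ?A \<Longrightarrow> p * q \<in> ?A" for c p q
    using subalgebra_alg_generated[of invariant_generators] by (auto simp: Defs.subalgebra_def)
  have gen: "phi_indet v \<in> ?A" for v
    using alg_generated_superset[of invariant_generators] by (auto simp: invariant_generators_eq)
  have "phi f \<in> ?A" for f
    unfolding phi_def
    by (induction f rule: polyalg_span_induct)
      (auto simp: subst_add subst_mult subst_Const subst_one gen intro: A A(1)[of 1, simplified])
  then show ?thesis by auto
qed

lemma alg_generated_subset_invariants: "alg_generated invariant_generators \<subseteq> S4_invariants"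
  unfolding alg_generated_def
  by (rule hull_minimal) (auto simp: invariant_generators_eq phi_indet_invariant subalgebra_S4_invariants)

section \<open>Multisymmetric power sums\<close>

text \<open>By inclusion and exclusion, the right-hand side minus the left-hand side is the sum of the products
  \<open>p\<^sub>i q\<^sub>j r\<^sub>k w\<^sub>l\<close> over all choices of four different indices; but there are only three indices.\<close>

lemma three_point_trace_identity:
  fixes p1 p2 p3 q1 q2 q3 r1 r2 r3 w1 w2 w3 :: "'r::idom"
  shows "6 * (p1*q1*r1*w1 + p2*q2*r2*w2 + p3*q3*r3*w3) =
      (p1+p2+p3) * (q1+q2+q3) * (r1+r2+r3) * (w1+w2+w3)
    - (p1*q1+p2*q2+p3*q3) * (r1+r2+r3) * (w1+w2+w3)
    - (p1*r1+p2*r2+p3*r3) * (q1+q2+q3) * (w1+w2+w3)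
    - (p1*w1+p2*w2+p3*w3) * (q1+q2+q3) * (r1+r2+r3)
    - (q1*r1+q2*r2+q3*r3) * (p1+p2+p3) * (w1+w2+w3)
    - (q1*w1+q2*w2+q3*w3) * (p1+p2+p3) * (r1+r2+r3)
    - (r1*w1+r2*w2+r3*w3) * (p1+p2+p3) * (q1+q2+q3)
    + (p1*q1+p2*q2+p3*q3) * (r1*w1+r2*w2+r3*w3)
    + (p1*r1+p2*r2+p3*r3) * (q1*w1+q2*w2+q3*w3)
    + (p1*w1+p2*w2+p3*w3) * (q1*r1+q2*r2+q3*r3)
    + 2 * (p1*q1*r1+p2*q2*r2+p3*q3*r3) * (w1+w2+w3)
    + 2 * (p1*q1*w1+p2*q2*w2+p3*q3*w3) * (r1+r2+r3)
    + 2 * (p1*r1*w1+p2*r2*w2+p3*r3*w3) * (q1+q2+q3)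
    + 2 * (q1*r1*w1+q2*r2*w2+q3*r3*w3) * (p1+p2+p3)"
  by Groebner_Basis.algebra

lemma polyalg_three_point_trace_identity:
  fixes p1 p2 p3 q1 q2 q3 r1 r2 r3 w1 w2 w3 :: "('v, 'a::field) polyalg"
  shows "6 * (p1*q1*r1*w1 + p2*q2*r2*w2 + p3*q3*r3*w3) =
      (p1+p2+p3) * (q1+q2+q3) * (r1+r2+r3) * (w1+w2+w3)
    - (p1*q1+p2*q2+p3*q3) * (r1+r2+r3) * (w1+w2+w3)
    - (p1*r1+p2*r2+p3*r3) * (q1+q2+q3) * (w1+w2+w3)
    - (p1*w1+p2*w2+p3*w3) * (q1+q2+q3) * (r1+r2+r3)
    - (q1*r1+q2*r2+q3*r3) * (p1+p2+p3) * (w1+w2+w3)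
    - (q1*w1+q2*w2+q3*w3) * (p1+p2+p3) * (r1+r2+r3)
    - (r1*w1+r2*w2+r3*w3) * (p1+p2+p3) * (q1+q2+q3)
    + (p1*q1+p2*q2+p3*q3) * (r1*w1+r2*w2+r3*w3)
    + (p1*r1+p2*r2+p3*r3) * (q1*w1+q2*w2+q3*w3)
    + (p1*w1+p2*w2+p3*w3) * (q1*r1+q2*r2+q3*r3)
    + 2 * (p1*q1*r1+p2*q2*r2+p3*q3*r3) * (w1+w2+w3)
    + 2 * (p1*q1*w1+p2*q2*w2+p3*q3*w3) * (r1+r2+r3)
    + 2 * (p1*r1*w1+p2*r2*w2+p3*r3*w3) * (q1+q2+q3)
    + 2 * (q1*r1*w1+q2*r2*w2+q3*r3*w3) * (p1+p2+p3)"
  by (rule polyalg_eqI_aeval) (simp only: aeval_add aeval_diff aeval_mult aeval_numeral three_point_trace_identity)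

text \<open>Inclusion and exclusion for three families: here the sum over different indices is the symmetrised
  product, which thereby becomes a polynomial in power sums.\<close>

lemma symmetrized_product:
  fixes p1 p2 p3 q1 q2 q3 r1 r2 r3 :: "'r::comm_ring_1"
  shows "p1*q2*r3 + p1*q3*r2 + p2*q1*r3 + p2*q3*r1 + p3*q1*r2 + p3*q2*r1 =
      (p1+p2+p3) * (q1+q2+q3) * (r1+r2+r3)
    - (p1*q1+p2*q2+p3*q3) * (r1+r2+r3) - (p1*r1+p2*r2+p3*r3) * (q1+q2+q3)
    - (q1*r1+q2*r2+q3*r3) * (p1+p2+p3) + 2 * (p1*q1*r1+p2*q2*r2+p3*q3*r3)"
  by (simp add: algebra_simps)

lemma range_phi_closed:
  "Const c \<in> range phi" "1 \<in> range phi" "numeral n \<in> range phi" "0 \<in> range phi"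
  "p \<in> range phi \<Longrightarrow> q \<in> range phi \<Longrightarrow> p + q \<in> range phi"
  "p \<in> range phi \<Longrightarrow> q \<in> range phi \<Longrightarrow> p * q \<in> range phi"
  "p \<in> range phi \<Longrightarrow> q \<in> range phi \<Longrightarrow> p - q \<in> range phi"
  "p \<in> range phi \<Longrightarrow> p ^ k \<in> range phi"
proof -
  have hom: "phi (Const c) = Const c" "phi 1 = 1" "phi (numeral n) = numeral n" "phi 0 = 0"
      "phi f + phi g = phi (f + g)" "phi f * phi g = phi (f * g)" "phi f - phi g = phi (f - g)" "phi f ^ k = phi (f ^ k)"
    for c n f g k
    by (simp_all add: phi_def subst_Const subst_one subst_numeral subst_add subst_mult subst_diff subst_power)
  show "Const c \<in> range phi" "1 \<in> range phi" "numeral n \<in> range phi" "0 \<in> range phi"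
    by (rule range_eqI, rule hom(1-4)[symmetric])+
  show "p \<in> range phi \<Longrightarrow> q \<in> range phi \<Longrightarrow> p + q \<in> range phi"
    "p \<in> range phi \<Longrightarrow> q \<in> range phi \<Longrightarrow> p * q \<in> range phi"
    "p \<in> range phi \<Longrightarrow> q \<in> range phi \<Longrightarrow> p - q \<in> range phi"
    "p \<in> range phi \<Longrightarrow> p ^ k \<in> range phi"
    by (auto simp: hom(5-8))
qed

lemma Const_inverse_numeral:
  assumes "(numeral n :: 'a::field) \<noteq> 0"
  shows "Const (1 / numeral n :: 'a) * (numeral n * p) = (p :: ('v, 'a) polyalg)"
proof -
  have "(Const (of_nat k :: 'a) :: ('v, 'a) polyalg) = of_nat k" for k
    by (induction k) (simp_all add: Const_add)
  from this[of "numeral n"] have "(numeral n :: ('v, 'a) polyalg) = Const (numeral n)" by simp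
  then have "Const (1 / numeral n :: 'a) * (numeral n * p) = Const (1 / numeral n * numeral n) * p"
    by (simp only: Const_mult mult.assoc)
  with assms show ?thesis by simp
qed

lemma range_phi_cancel_numeral:
  assumes "(numeral n :: 'a::field) \<noteq> 0" "numeral n * p \<in> range (phi :: (indet, 'a) polyalg \<Rightarrow> _)"
  shows "p \<in> range (phi :: (indet, 'a) polyalg \<Rightarrow> _)"
  using range_phi_closed(6)[OF range_phi_closed(1) assms(2), of "1 / numeral n"]
  by (simp add: Const_inverse_numeral[OF assms(1)])

lemma power_sum_small:
  assumes "a + b \<le> 3"
  shows "br a (2 * b) \<in> range phi"
proof -
  have gen: "phi_indet v \<in> range phi" for v
    by (rule range_eqI[of _ _ "Var v"]) (simp add: phi_Var)
  have zero: "br 0 0 \<in> range phi"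
    using range_phi_closed(3)[of "num.Bit1 num.One"] by (simp add: br_def)
  have "a \<in> {0, 1, 2, 3}" "b \<in> {0, 1, 2, 3}"
    using assms by auto
  with assms zero gen[of Tx] gen[of Tx2] gen[of Tx3] gen[of Ty] gen[of Ty2] gen[of Ty3] gen[of Txy] gen[of Tx2y] gen[of Txy2]
  show ?thesis
    by (elim insertE emptyE) simp_all
qed

text \<open>The trace identity for four nonconstant monomials \<open>x\<^sup>ay\<^sup>b\<close>: all power sums other than that
  of the product of the four have smaller degree.\<close>

lemma power_sum_step:
  assumes nz: "(6 :: 'a::field) \<noteq> 0"
    and smaller: "\<And>c d. c + d < a1 + a2 + a3 + a4 + (b1 + b2 + b3 + b4) \<Longrightarrow>
      br c (2 * d) \<in> range (phi :: (indet, 'a) polyalg \<Rightarrow> _)"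
    and pos: "0 < a1 + b1" "0 < a2 + b2" "0 < a3 + b3" "0 < a4 + b4"
  shows "br (a1 + a2 + a3 + a4) (2 * (b1 + b2 + b3 + b4)) \<in> range (phi :: (indet, 'a) polyalg \<Rightarrow> _)"
proof -
  define m :: "nat \<Rightarrow> nat \<Rightarrow> (edge, 'a) polyalg \<Rightarrow> (edge, 'a) polyalg \<Rightarrow> (edge, 'a) polyalg"
    where "m a b x z = x ^ a * z ^ (2 * b)" for a b x z
  have m_mult: "m a b x z * m c d x z = m (a + c) (b + d) x z" for a b c d x z
    by (simp add: m_def power_add distrib_left ac_simps)
  have br: "m a b x1 z1 + m a b x2 z2 + m a b x3 z3 = br a (2 * b)" for a b
    by (simp add: m_def br_def)
  note trace = polyalg_three_point_trace_identity[of
      "m a1 b1 x1 z1" "m a2 b2 x1 z1" "m a3 b3 x1 z1" "m a4 b4 x1 z1"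
      "m a1 b1 x2 z2" "m a2 b2 x2 z2" "m a3 b3 x2 z2" "m a4 b4 x2 z2"
      "m a1 b1 x3 z3" "m a2 b2 x3 z3" "m a3 b3 x3 z3" "m a4 b4 x3 z3", unfolded m_mult br]
  have "6 * br (a1 + a2 + a3 + a4) (2 * (b1 + b2 + b3 + b4)) \<in> range (phi :: (indet, 'a) polyalg \<Rightarrow> _)"
    unfolding trace
    by (intro range_phi_closed smaller) (use pos in linarith)+
  then show ?thesis by (rule range_phi_cancel_numeral[OF nz])
qed

text \<open>By induction on the degree. From degree 4 on, three single variables are split off,
  and the fourth factor is what remains.\<close>

lemma power_sum_in_range_phi:
  assumes nz: "(6 :: 'a::field) \<noteq> 0"
  shows "br a (2 * b) \<in> range (phi :: (indet, 'a) polyalg \<Rightarrow> _)"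
proof (induction "a + b" arbitrary: a b rule: less_induct)
  case less
  have step: "br a (2 * b) \<in> range (phi :: (indet, 'a) polyalg \<Rightarrow> _)"
    if "a = a1 + a2 + a3 + a4" "b = b1 + b2 + b3 + b4" "0 < a1 + b1" "0 < a2 + b2" "0 < a3 + b3" "0 < a4 + b4"
    for a1 a2 a3 a4 b1 b2 b3 b4
    unfolding that(1,2) by (rule power_sum_step[OF nz _ that(3-6)], rule less) (simp add: that(1,2))
  consider "a + b \<le> 3" | "3 \<le> a" "4 \<le> a + b" | "a = 2" "4 \<le> a + b" | "a = 1" "4 \<le> a + b" | "a = 0" "4 \<le> a + b"
    by linarith
  then show ?case
  proof cases
    case 1
    then show ?thesis by (rule power_sum_small)
  next
    case 2
    then show ?thesis by (intro step[of 1 1 1 "a - 3" 0 0 0 b]) simp_all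
  next
    case 3
    then show ?thesis by (intro step[of 1 1 0 0 0 0 1 "b - 1"]) simp_all
  next
    case 4
    then show ?thesis by (intro step[of 1 0 0 0 0 1 1 "b - 2"]) simp_all
  next
    case 5
    then show ?thesis by (intro step[of 0 0 0 0 1 1 1 "b - 3"]) simp_all
  qed
qed

section \<open>Averaging over the symmetric group\<close>

text \<open>The linear span of the monomials in the coordinates \<open>x\<^sub>i\<close> and \<open>z\<^sub>i\<close>. It is described by its
  closure properties, since linear statements about averages are then proved by
  rule induction.\<close>

inductive_set xz_span :: "(edge, 'a::field) polyalg set" where
  monomial: "x1 ^ a1 * x2 ^ a2 * x3 ^ a3 * (z1 ^ b1 * z2 ^ b2 * z3 ^ b3) \<in> xz_span"
| add: "p \<in> xz_span \<Longrightarrow> q \<in> xz_span \<Longrightarrow> p + q \<in> xz_span"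
| scale: "p \<in> xz_span \<Longrightarrow> Const c * p \<in> xz_span"

lemma xz_span_mult:
  assumes "p \<in> xz_span"
  shows "x1 * p \<in> xz_span" "x2 * p \<in> xz_span" "x3 * p \<in> xz_span"
    "z1 * p \<in> xz_span" "z2 * p \<in> xz_span" "z3 * p \<in> xz_span"
proof -
  have "x1 * p \<in> xz_span \<and> x2 * p \<in> xz_span \<and> x3 * p \<in> xz_span
      \<and> z1 * p \<in> xz_span \<and> z2 * p \<in> xz_span \<and> z3 * p \<in> xz_span"
    using assms
  proof induction
    case (monomial a1 a2 a3 b1 b2 b3)
    show ?case
      using xz_span.monomial[of "Suc a1" a2 a3 b1 b2 b3] xz_span.monomial[of a1 "Suc a2" a3 b1 b2 b3]
        xz_span.monomial[of a1 a2 "Suc a3" b1 b2 b3] xz_span.monomial[of a1 a2 a3 "Suc b1" b2 b3]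
        xz_span.monomial[of a1 a2 a3 b1 "Suc b2" b3] xz_span.monomial[of a1 a2 a3 b1 b2 "Suc b3"]
      by (simp add: ac_simps)
  next
    case (add p q)
    then show ?case by (simp add: distrib_left xz_span.add)
  next
    case (scale p c)
    then show ?case by (simp add: mult.left_commute[of _ "Const c"] xz_span.scale)
  qed
  then show "x1 * p \<in> xz_span" "x2 * p \<in> xz_span" "x3 * p \<in> xz_span"
    "z1 * p \<in> xz_span" "z2 * p \<in> xz_span" "z3 * p \<in> xz_span" by auto
qed

lemma Const_uminus: "Const (- c) = - Const c"
  using Const_add[of c "- c"] by (simp add: eq_neg_iff_add_eq_0 add.commute)

lemma xz_span_diff: "p \<in> xz_span \<Longrightarrow> q \<in> xz_span \<Longrightarrow> p - q \<in> xz_span"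
  using xz_span.add[OF _ xz_span.scale[of q "- 1"], of p] by (simp add: Const_uminus)

lemma edge_cases:
  obtains "e = Abs_edge {1, 2}" | "e = Abs_edge {3, 4}" | "e = Abs_edge {1, 3}"
    | "e = Abs_edge {2, 4}" | "e = Abs_edge {1, 4}" | "e = Abs_edge {2, 3}"
proof -
  obtain i j where e: "Rep_edge e = {i, j}" "i \<noteq> j" "i \<in> {1..4}" "j \<in> {1..4}"
    using Rep_edge[of e] by (auto simp: card_2_iff)
  from e have ij: "i = 1 \<or> i = 2 \<or> i = 3 \<or> i = 4" "j = 1 \<or> j = 2 \<or> j = 3 \<or> j = 4" by auto
  from e(2) have "Rep_edge e = {1, 2} \<or> Rep_edge e = {3, 4} \<or> Rep_edge e = {1, 3} \<or>
      Rep_edge e = {2, 4} \<or> Rep_edge e = {1, 4} \<or> Rep_edge e = {2, 3}"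
    unfolding e(1) by (insert ij, elim disjE) (simp_all add: doubleton_eq_iff)
  then show ?thesis using that Rep_edge_inverse[of e] by metis
qed

lemma in_xz_span:
  assumes nz: "(2 :: 'a::field) \<noteq> 0"
  shows "(p :: (edge, 'a) polyalg) \<in> xz_span"
proof (induction p rule: polyalg_span_induct)
  case one
  show ?case using xz_span.monomial[of 0 0 0 0 0 0] by simp
next
  case (var e p)
  have half: "q \<in> xz_span" if "2 * q \<in> xz_span" for q :: "(edge, 'a) polyalg"
    using xz_span.scale[OF that, of "1 / 2"] by (simp add: Const_inverse_numeral[OF nz])
  note closed = xz_span_mult[OF var] xz_span.add xz_span_diff
  have two: "2 * (xe 1 2 * p) = x1 * p + z1 * p" "2 * (xe 3 4 * p) = x1 * p - z1 * p"
    "2 * (xe 1 3 * p) = x2 * p + z2 * p" "2 * (xe 2 4 * p) = x2 * p - z2 * p"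
    "2 * (xe 1 4 * p) = x3 * p + z3 * p" "2 * (xe 2 3 * p) = x3 * p - z3 * p"
    by (simp_all add: xz_defs algebra_simps)
  have "xe 1 2 * p \<in> xz_span" "xe 3 4 * p \<in> xz_span" "xe 1 3 * p \<in> xz_span"
    "xe 2 4 * p \<in> xz_span" "xe 1 4 * p \<in> xz_span" "xe 2 3 * p \<in> xz_span"
    by (rule half, simp only: two closed)+
  then show ?case by (cases e rule: edge_cases) (simp_all add: xe_def)
qed (auto intro: xz_span.add xz_span.scale)

abbreviation "swap i j \<equiv> perm_act (Transposition.transpose i j)"

text \<open>The average over \<open>S\<^sub>4\<close>, up to the factor 24, is taken in two stages: first over the Klein
  four-group, then over the representatives of its cosets formed by the permutations of \<open>{1, 2, 3}\<close>.\<close>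

definition klein_sum :: "(edge, 'a::field) polyalg \<Rightarrow> (edge, 'a) polyalg" where
  "klein_sum p = (let q = p + swap 1 2 (swap 3 4 p) in q + swap 1 3 (swap 2 4 q))"

definition S3_sum :: "(edge, 'a::field) polyalg \<Rightarrow> (edge, 'a) polyalg" where
  "S3_sum p = (let q = p + swap 1 2 p in q + swap 1 2 (swap 2 3 q) + swap 2 3 (swap 1 2 q))"

lemma S3_klein_sum_invariant:
  assumes "p \<in> S4_invariants"
  shows "S3_sum (klein_sum p) = 24 * p"
proof -
  have [simp]: "swap i j p = p" if "i \<in> {1..4}" "j \<in> {1..4}" for i j
    using assms that by (simp add: S4_invariants_def permutes_swap_id)
  show ?thesis
    by (simp add: S3_sum_def klein_sum_def Let_def perm_act_hom del: One_nat_def)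
qed

text \<open>The Klein four-group acts on a monomial by the signs \<open>(-1)\<^bsup>b\<^sub>i + b\<^sub>j\<^esup>\<close>, so the sum is zero unless the
  three exponents of the \<open>z\<^sub>i\<close> have the same parity.\<close>

lemma klein_sum_monomial:
  fixes m :: "(edge, 'a::field) polyalg"
  assumes m: "m = x1 ^ a1 * x2 ^ a2 * x3 ^ a3 * (z1 ^ b1 * z2 ^ b2 * z3 ^ b3)"
  shows "klein_sum m = (if even (b1 + b2) \<and> even (b2 + b3) then 4 * m else 0)"
proof -
  have "swap 1 2 (swap 3 4 m) = (- 1) ^ (b2 + b3) * m"
    unfolding m
    by (cases "even b2"; cases "even b3") (simp_all add: perm_act_hom perm_act_xz del: One_nat_def)
  moreover have "swap 1 3 (swap 2 4 m) = (- 1) ^ (b1 + b3) * m"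
    unfolding m
    by (cases "even b1"; cases "even b3") (simp_all add: perm_act_hom perm_act_xz del: One_nat_def)
  ultimately show ?thesis
    by (cases "even b1"; cases "even b2"; cases "even b3")
      (simp_all add: klein_sum_def Let_def perm_act_hom uminus_add_conv_diff del: One_nat_def)
qed

text \<open>The permutations of \<open>{1, 2, 3}\<close> permute the pairs \<open>(x\<^sub>i, z\<^sub>i\<^sup>2)\<close> and fix \<open>z\<^sub>1z\<^sub>2z\<^sub>3\<close>, so that the
  sum is a symmetrised product of monomials.\<close>

lemma S3_sum_monomial:
  assumes nz: "(6 :: 'a::field) \<noteq> 0"
  shows "S3_sum ((z1 * z2 * z3) ^ e *
      (x1 ^ a1 * z1 ^ (2 * b1) * (x2 ^ a2 * z2 ^ (2 * b2)) * (x3 ^ a3 * z3 ^ (2 * b3))))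
    \<in> range (phi :: (indet, 'a) polyalg \<Rightarrow> _)"
proof -
  define m :: "nat \<Rightarrow> nat \<Rightarrow> (edge, 'a) polyalg \<Rightarrow> (edge, 'a) polyalg \<Rightarrow> (edge, 'a) polyalg"
    where "m a b x z = x ^ a * z ^ (2 * b)" for a b x z
  define s :: "(edge, 'a) polyalg" where "s = z1 * z2 * z3"
  have m_mult: "m a b x z * m c d x z = m (a + c) (b + d) x z" for a b c d x z
    by (simp add: m_def power_add distrib_left ac_simps)
  have br: "m a b x1 z1 + m a b x2 z2 + m a b x3 z3 = br a (2 * b)" for a b
    by (simp add: m_def br_def)
  have act: "swap 1 2 s = s" "swap 2 3 s = s"
    "swap 1 2 (m a b x1 z1) = m a b x1 z1" "swap 1 2 (m a b x2 z2) = m a b x3 z3" "swap 1 2 (m a b x3 z3) = m a b x2 z2"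
    "swap 2 3 (m a b x1 z1) = m a b x2 z2" "swap 2 3 (m a b x2 z2) = m a b x1 z1" "swap 2 3 (m a b x3 z3) = m a b x3 z3"
    for a b
    by (simp_all add: s_def m_def perm_act_hom perm_act_xz del: One_nat_def)
  have "S3_sum (s ^ e * (m a1 b1 x1 z1 * m a2 b2 x2 z2 * m a3 b3 x3 z3)) =
    s ^ e * (m a1 b1 x1 z1 * m a2 b2 x2 z2 * m a3 b3 x3 z3 + m a1 b1 x1 z1 * m a2 b2 x3 z3 * m a3 b3 x2 z2
      + m a1 b1 x2 z2 * m a2 b2 x1 z1 * m a3 b3 x3 z3 + m a1 b1 x2 z2 * m a2 b2 x3 z3 * m a3 b3 x1 z1
      + m a1 b1 x3 z3 * m a2 b2 x1 z1 * m a3 b3 x2 z2 + m a1 b1 x3 z3 * m a2 b2 x2 z2 * m a3 b3 x1 z1)"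
    by (simp add: S3_sum_def Let_def perm_act_hom act distrib_left ac_simps del: One_nat_def)
  also have "\<dots> \<in> range (phi :: (indet, 'a) polyalg \<Rightarrow> _)"
  proof -
    have "s = phi (Var S)" by (simp add: s_def phi_Var)
    then have "s \<in> range phi" by simp
    then show ?thesis
      unfolding symmetrized_product m_mult br
      by (intro range_phi_closed power_sum_in_range_phi[OF nz])
  qed
  finally show ?thesis by (simp add: m_def s_def)
qed

text \<open>If the exponents of the \<open>z\<^sub>i\<close> have the same parity, the monomial is \<open>(z\<^sub>1z\<^sub>2z\<^sub>3)\<^sup>e\<close> times a
  monomial in the \<open>x\<^sub>i\<close> and the \<open>z\<^sub>i\<^sup>2\<close>, where \<open>e\<close> is \<open>0\<close> or \<open>1\<close>.\<close>

lemma S3_klein_sum_in_range_phi: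
  assumes nz: "(6 :: 'a::field) \<noteq> 0" and "p \<in> xz_span"
  shows "S3_sum (klein_sum p) \<in> range (phi :: (indet, 'a) polyalg \<Rightarrow> _)"
  using assms(2)
proof induction
  case (monomial a1 a2 a3 b1 b2 b3)
  let ?m = "x1 ^ a1 * x2 ^ a2 * x3 ^ a3 * (z1 ^ b1 * z2 ^ b2 * z3 ^ b3) :: (edge, 'a) polyalg"
  show ?case
  proof (cases "even (b1 + b2) \<and> even (b2 + b3)")
    case True
    then obtain e c1 c2 c3 where b: "b1 = e + 2 * c1" "b2 = e + 2 * c2" "b3 = e + 2 * c3"
    proof -
      have "b1 = b1 mod 2 + 2 * (b1 div 2)" "b2 = b1 mod 2 + 2 * (b2 div 2)" "b3 = b1 mod 2 + 2 * (b3 div 2)"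
        using True by presburger+
      then show ?thesis by (rule that)
    qed
    have "?m = (z1 * z2 * z3) ^ e *
        (x1 ^ a1 * z1 ^ (2 * c1) * (x2 ^ a2 * z2 ^ (2 * c2)) * (x3 ^ a3 * z3 ^ (2 * c3)))"
      unfolding b power_add power_mult_distrib by (simp only: ac_simps)
    then have "S3_sum ?m \<in> range (phi :: (indet, 'a) polyalg \<Rightarrow> _)"
      by (simp only: S3_sum_monomial[OF nz])
    moreover have "S3_sum (4 * ?m) = 4 * S3_sum ?m"
      by (simp add: S3_sum_def Let_def perm_act_hom distrib_left del: One_nat_def)
    ultimately show ?thesis
      using True by (simp add: klein_sum_monomial[OF refl] range_phi_closed)
  next
    case False
    then show ?thesis
      by (simp only: klein_sum_monomial[OF refl] if_False)
        (simp add: S3_sum_def perm_act_hom range_phi_closed)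
  qed
next
  case (add p q)
  have "S3_sum (klein_sum (p + q)) = S3_sum (klein_sum p) + S3_sum (klein_sum q)"
    by (simp add: S3_sum_def klein_sum_def Let_def perm_act_hom ac_simps del: One_nat_def)
  with add show ?case by (simp add: range_phi_closed)
next
  case (scale p c)
  have "S3_sum (klein_sum (Const c * p)) = Const c * S3_sum (klein_sum p)"
    by (simp add: S3_sum_def klein_sum_def Let_def perm_act_hom distrib_left del: One_nat_def)
  with scale show ?case by (simp add: range_phi_closed)
qed

lemma invariants_subset_range_phi:
  assumes "(2 :: 'a::field) \<noteq> 0" "(3 :: 'a) \<noteq> 0"
  shows "S4_invariants \<subseteq> range (phi :: (indet, 'a) polyalg \<Rightarrow> _)"
proof
  fix p :: "(edge, 'a) polyalg" assume p: "p \<in> S4_invariants"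
  note nz = numerals_nonzero(1,3)[OF assms]
  have "24 * p \<in> range (phi :: (indet, 'a) polyalg \<Rightarrow> _)"
    using S3_klein_sum_in_range_phi[OF nz(1) in_xz_span[OF assms(1)], of p] p
    by (simp add: S3_klein_sum_invariant)
  then show "p \<in> range (phi :: (indet, 'a) polyalg \<Rightarrow> _)"
    by (rule range_phi_cancel_numeral[OF nz(2)])
qed

section \<open>Reduction to a normal form modulo the relations\<close>

lemma ideal_generated_base: "b \<in> B \<Longrightarrow> b \<in> ideal_generated B"
  unfolding ideal_generated_def by (rule module.span_base[OF module_mult])

lemma ideal_generated_zero: "0 \<in> ideal_generated B"
  unfolding ideal_generated_def by (rule module.span_zero[OF module_mult])

lemma ideal_generated_add: "p \<in> ideal_generated B \<Longrightarrow> q \<in> ideal_generated B \<Longrightarrow> p + q \<in> ideal_generated B"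
  unfolding ideal_generated_def by (rule module.span_add[OF module_mult])

lemma ideal_generated_mult: "q \<in> ideal_generated B \<Longrightarrow> p * q \<in> ideal_generated B"
  unfolding ideal_generated_def by (rule module.span_scale[OF module_mult])

lemma ideal_generated_minimal:
  assumes "0 \<in> I" "\<And>p q. p \<in> I \<Longrightarrow> q \<in> I \<Longrightarrow> p + q \<in> I" "\<And>p q. q \<in> I \<Longrightarrow> p * q \<in> I" "B \<subseteq> I"
  shows "ideal_generated B \<subseteq> I"
  unfolding ideal_generated_def
  by (rule module.span_minimal[OF module_mult]) (use assms in \<open>auto simp: module.subspace_def[OF module_mult]\<close>)

definition kernel_generators :: "(indet, 'a::field) polyalg set"
  where "kernel_generators = {rel_S, J32, J23, J42, J33, J24}"

definition param_vars :: "indet set"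
  where "param_vars = {Tx, Tx2, Tx3, Ty, Ty2, Ty3}"

text \<open>The subalgebra \<open>P\<close> over which the normal form is linear. Its elements go to the
  polynomials that are symmetric in the \<open>x\<^sub>i\<close> and the \<open>y\<^sub>i\<close> separately.\<close>

definition params :: "(indet, 'a::field) polyalg set"
  where "params = {p. poly_vars p \<subseteq> param_vars}"

lemma params_closed:
  "Const c \<in> params" "1 \<in> params" "0 \<in> params" "numeral n \<in> params"
  "p \<in> params \<Longrightarrow> q \<in> params \<Longrightarrow> p + q \<in> params"
  "p \<in> params \<Longrightarrow> q \<in> params \<Longrightarrow> p * q \<in> params"
  "p \<in> params \<Longrightarrow> - p \<in> params"
  "p \<in> params \<Longrightarrow> q \<in> params \<Longrightarrow> p - q \<in> params"
  "p \<in> params \<Longrightarrow> p ^ k \<in> params"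
  "t Tx \<in> params" "t Tx2 \<in> params" "t Tx3 \<in> params" "t Ty \<in> params" "t Ty2 \<in> params" "t Ty3 \<in> params"
proof -
  show const: "Const c \<in> params" for c
    by (simp add: params_def)
  show one: "1 \<in> params" and zero: "0 \<in> params"
    using const[of 1] const[of 0] by simp_all
  show add: "p \<in> params \<Longrightarrow> q \<in> params \<Longrightarrow> p + q \<in> params" for p q
    using poly_vars_add[of p q] by (auto simp: params_def)
  show mult: "p \<in> params \<Longrightarrow> q \<in> params \<Longrightarrow> p * q \<in> params" for p q
    using poly_vars_mult[of p q] by (auto simp: params_def)
  have "of_nat k \<in> params" for k
    by (induction k) (auto intro: one zero add)
  from this[of "numeral n"] show "numeral n \<in> params" by simp
  show uminus: "p \<in> params \<Longrightarrow> - p \<in> params" for p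
    by (simp add: params_def poly_vars_def)
  show "p \<in> params \<Longrightarrow> q \<in> params \<Longrightarrow> p - q \<in> params"
    using add[OF _ uminus, of p q] by simp
  show "p \<in> params \<Longrightarrow> p ^ k \<in> params"
    by (induction k) (auto intro: one mult)
  show "t Tx \<in> params" "t Tx2 \<in> params" "t Tx3 \<in> params" "t Ty \<in> params" "t Ty2 \<in> params" "t Ty3 \<in> params"
    by (simp_all add: params_def param_vars_def poly_vars_def Var_def)
qed

text \<open>The sum of the ideal of relations and the \<open>P\<close>-module generated by \<open>G\<close>.\<close>

inductive_set span_mod :: "(indet, 'a::field) polyalg set \<Rightarrow> (indet, 'a) polyalg set" for G where
  ideal: "p \<in> ideal_generated kernel_generators \<Longrightarrow> p \<in> span_mod G"
| gen: "g \<in> G \<Longrightarrow> g \<in> span_mod G"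
| add: "p \<in> span_mod G \<Longrightarrow> q \<in> span_mod G \<Longrightarrow> p + q \<in> span_mod G"
| scale: "c \<in> params \<Longrightarrow> p \<in> span_mod G \<Longrightarrow> c * p \<in> span_mod G"

lemma span_mod_diff: "p \<in> span_mod G \<Longrightarrow> q \<in> span_mod G \<Longrightarrow> p - q \<in> span_mod G"
  using span_mod.add[OF _ span_mod.scale[of "- 1" q], of p] by (simp add: params_closed)

lemma span_mod_mult:
  assumes "p \<in> span_mod G" "\<And>g. g \<in> G \<Longrightarrow> q * g \<in> span_mod H"
  shows "q * p \<in> span_mod H"
  using assms(1)
proof induction
  case (ideal p)
  then show ?case by (intro span_mod.ideal ideal_generated_mult)
next
  case (scale c p)
  then show ?case by (simp add: mult.left_commute[of q c] span_mod.scale)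
qed (auto simp: distrib_left intro: assms span_mod.add)

lemma span_mod_mono: "p \<in> span_mod G \<Longrightarrow> G \<subseteq> H \<Longrightarrow> p \<in> span_mod H"
  using span_mod_mult[of p G 1 H] by (auto intro: span_mod.gen)

lemma span_mod_cancel_numeral:
  assumes "(numeral n :: 'a::field) \<noteq> 0" "numeral n * p \<in> span_mod (G :: (indet, 'a) polyalg set)"
  shows "p \<in> span_mod G"
  using span_mod.scale[OF params_closed(1) assms(2), of "1 / numeral n"]
  by (simp add: Const_inverse_numeral[OF assms(1)])

text \<open>The elements whose products with \<open>u\<close>, \<open>v\<close> and \<open>w\<close> are rewritten without a formula for
  \<open>u\<^sup>4\<close>. Their span contains \<open>uv\<close> and \<open>uw\<close>, so products with one of these as a factor can be rewritten
  once more.\<close>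

definition low_basis :: "(indet, 'a::field) polyalg set"
  where "low_basis = {1, t Txy, t Tx2y, t Txy2, t Txy ^ 2}"

definition even_basis :: "(indet, 'a::field) polyalg set"
  where "even_basis = insert (t Txy ^ 3) low_basis"

lemma even_basis_cases: "g \<in> even_basis \<Longrightarrow> g = t Txy ^ 3 \<or> g \<in> low_basis"
  by (simp add: even_basis_def)

lemma low_basis_span:
  "1 \<in> span_mod low_basis" "t Txy \<in> span_mod low_basis" "t Tx2y \<in> span_mod low_basis"
  "t Txy2 \<in> span_mod low_basis" "t Txy ^ 2 \<in> span_mod low_basis"
  by (auto simp: low_basis_def intro: span_mod.gen)

lemma relation_in_span_mod: "p \<in> kernel_generators \<Longrightarrow> p \<in> span_mod G"
  by (intro span_mod.ideal ideal_generated_base)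

lemma relations_in_span_mod:
  "rel_S \<in> span_mod G" "J32 \<in> span_mod G" "J23 \<in> span_mod G" "J42 \<in> span_mod G" "J33 \<in> span_mod G" "J24 \<in> span_mod G"
  by (rule relation_in_span_mod, simp add: kernel_generators_def)+

lemma low_products:
  assumes nz: "(6 :: 'a::field) \<noteq> 0"
  shows "t Txy * t Tx2y \<in> span_mod (low_basis :: (indet, 'a) polyalg set)"
    and "t Txy * t Txy2 \<in> span_mod (low_basis :: (indet, 'a) polyalg set)"
    and "t Tx2y * t Tx2y \<in> span_mod (low_basis :: (indet, 'a) polyalg set)"
    and "t Txy2 * t Txy2 \<in> span_mod (low_basis :: (indet, 'a) polyalg set)"
proof -
  note closed = span_mod.add span_mod_diff span_mod.scale params_closed
  have "6 * (t Txy * t Tx2y :: (indet, 'a) polyalg) = J32 + 3 * t Tx2 * t Txy2 + 2 * t Tx * t Ty * t Tx2y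
      - t Tx^2 * t Txy2 + 4 * t Tx * t Txy^2 - 2 * t Tx^2 * t Ty * t Txy
      + (3 * t Tx3 * t Ty2 - 4 * t Tx2 * t Tx * t Ty2 + t Tx^3 * t Ty2 - t Tx3 * t Ty^2 + t Tx2 * t Tx * t Ty^2) * 1"
    by (simp add: J32_def algebra_simps)
  also have "\<dots> \<in> span_mod low_basis"
    by (intro low_basis_span relations_in_span_mod closed)
  finally show "t Txy * t Tx2y \<in> span_mod (low_basis :: (indet, 'a) polyalg set)"
    by (rule span_mod_cancel_numeral[OF nz])
  have "6 * (t Txy * t Txy2 :: (indet, 'a) polyalg) = J23 + 3 * t Ty2 * t Tx2y + 2 * t Ty * t Tx * t Txy2
      - t Ty^2 * t Tx2y + 4 * t Ty * t Txy^2 - 2 * t Ty^2 * t Tx * t Txy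
      + (3 * t Ty3 * t Tx2 - 4 * t Ty2 * t Ty * t Tx2 + t Ty^3 * t Tx2 - t Ty3 * t Tx^2 + t Ty2 * t Ty * t Tx^2) * 1"
    by (simp add: J23_def algebra_simps)
  also have "\<dots> \<in> span_mod low_basis"
    by (intro low_basis_span relations_in_span_mod closed)
  finally show "t Txy * t Txy2 \<in> span_mod (low_basis :: (indet, 'a) polyalg set)"
    by (rule span_mod_cancel_numeral[OF nz])
  have "6 * (t Tx2y * t Tx2y :: (indet, 'a) polyalg) = J42 - t Tx2 * t Txy^2 + 3 * t Tx^2 * t Txy^2 + 6 * t Tx3 * t Txy2
    - 2 * t Tx2 * t Tx * t Txy2 - 4 * t Tx3 * t Ty * t Txy + 2 * t Tx2 * t Tx * t Ty * t Txy
    - 2 * t Tx^3 * t Ty * t Txy + 4 * t Tx2 * t Ty * t Tx2y + (t Tx2^2 * t Ty2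
    - t Tx2^2 * t Ty^2 - 4 * t Tx2 * t Tx^2 * t Ty2 + t Tx2 * t Tx^2 * t Ty^2
    + t Tx^4 * t Ty2 + 2 * t Tx3 * t Tx * t Ty2) * 1"
    by (simp add: J42_def algebra_simps power2_eq_square)
  also have "\<dots> \<in> span_mod low_basis"
    by (intro low_basis_span relations_in_span_mod closed)
  finally show "t Tx2y * t Tx2y \<in> span_mod (low_basis :: (indet, 'a) polyalg set)"
    by (rule span_mod_cancel_numeral[OF nz])
  have "6 * (t Txy2 * t Txy2 :: (indet, 'a) polyalg) = J24 - t Ty2 * t Txy^2 + 3 * t Ty^2 * t Txy^2 + 6 * t Ty3 * t Tx2y
    - 2 * t Ty2 * t Ty * t Tx2y - 4 * t Ty3 * t Tx * t Txy + 2 * t Ty2 * t Tx * t Ty * t Txy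
    - 2 * t Ty^3 * t Tx * t Txy + 4 * t Ty2 * t Tx * t Txy2 + (t Ty2^2 * t Tx2
    - t Ty2^2 * t Tx^2 - 4 * t Ty2 * t Ty^2 * t Tx2 + t Ty2 * t Ty^2 * t Tx^2
    + t Ty^4 * t Tx2 + 2 * t Ty3 * t Ty * t Tx2) * 1"
    by (simp add: J24_def algebra_simps power2_eq_square)
  also have "\<dots> \<in> span_mod low_basis"
    by (intro low_basis_span relations_in_span_mod closed)
  finally show "t Txy2 * t Txy2 \<in> span_mod (low_basis :: (indet, 'a) polyalg set)"
    by (rule span_mod_cancel_numeral[OF nz])
qed

text \<open>Once \<open>uv\<close> and \<open>uw\<close> are rewritten, \<open>vw\<close> and \<open>u\<^sup>3\<close> are the only products in \<open>J\<^sub>3\<^sub>,\<^sub>3\<close> outside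
  the span of the small basis. The relation is used twice: to eliminate \<open>vw\<close>, and, multiplied by \<open>u\<close>, to
  eliminate \<open>u\<^sup>4\<close>.\<close>

lemma J33_tail:
  assumes nz: "(6 :: 'a::field) \<noteq> 0"
  obtains r :: "(indet, 'a::field) polyalg"
  where "r \<in> span_mod low_basis" "J33 = 3 * (t Tx2y * t Txy2) + t Txy ^ 3 + r"
proof
  note closed = span_mod.add span_mod_diff span_mod.scale params_closed
  let ?r = "2 * t Tx * (t Txy * t Txy2) + 2 * t Ty * (t Txy * t Tx2y)
    - 5 * t Tx * t Ty * t Txy^2 - t Tx2 * t Ty2 * t Txy + t Tx^2 * t Ty2 * t Txy
    + t Tx2 * t Ty^2 * t Txy + 2 * t Tx^2 * t Ty^2 * t Txy
    - 3 * t Tx2 * t Ty * t Txy2 - 3 * t Tx * t Ty2 * t Tx2y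
    + (t Tx2 * t Tx * t Ty3 - 3 * t Tx3 * t Ty3 + 3 * t Tx2 * t Tx * t Ty2 * t Ty + t Tx3 * t Ty2 * t Ty
    - t Tx^3 * t Ty2 * t Ty - t Tx2 * t Tx * t Ty^3) * 1 :: (indet, 'a) polyalg"
  have uv: "2 * t Ty * (t Txy * t Tx2y) \<in> span_mod (low_basis :: (indet, 'a) polyalg set)"
    and uw: "2 * t Tx * (t Txy * t Txy2) \<in> span_mod (low_basis :: (indet, 'a) polyalg set)"
    by (intro span_mod.scale params_closed low_products[OF nz])+
  show "?r \<in> span_mod low_basis"
    by (rule uv uw low_basis_span | rule closed)+
  show "J33 = 3 * (t Tx2y * t Txy2) + t Txy ^ 3 + ?r"
    by (simp add: J33_def algebra_simps)
qed

text \<open>Multiplying \<open>J\<^sub>3\<^sub>,\<^sub>3\<close> by \<open>u\<close> gives \<open>u\<^sup>4\<close> in terms of \<open>(uv)w\<close>, and \<open>uv\<close> lies in the small span,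
  which is carried into the large one by \<open>w\<close>. All other products need one rewriting step
  or are of the form \<open>u\<close> times a product already known.\<close>

lemma even_basis_mult:
  assumes nz2: "(2 :: 'a::field) \<noteq> 0" and nz3: "(3 :: 'a) \<noteq> 0"
    and p: "p \<in> span_mod (even_basis :: (indet, 'a) polyalg set)"
  shows "t Txy * p \<in> span_mod even_basis" "t Tx2y * p \<in> span_mod even_basis" "t Txy2 * p \<in> span_mod even_basis"
proof -
  let ?low = "span_mod (low_basis :: (indet, 'a) polyalg set)"
  let ?even = "span_mod (even_basis :: (indet, 'a) polyalg set)"
  note nz = numerals_nonzero(1)[OF nz2 nz3]
  note products = low_products[OF nz]
  have low_even: "q \<in> ?even" if "q \<in> ?low" for q
    using that by (rule span_mod_mono) (auto simp: even_basis_def)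
  obtain r :: "(indet, 'a) polyalg"
    where r: "r \<in> ?low" "J33 = 3 * (t Tx2y * t Txy2) + t Txy ^ 3 + r"
    by (rule J33_tail[OF nz])
  have u3: "t Txy ^ 3 \<in> ?even" by (intro span_mod.gen) (simp add: even_basis_def)
  have u_low: "t Txy * q \<in> ?even" if "q \<in> ?low" for q
    using that
  proof (rule span_mod_mult)
    fix g :: "(indet, 'a) polyalg" assume "g \<in> low_basis"
    then show "t Txy * g \<in> ?even"
      using low_even[OF products(1)] low_even[OF products(2)] low_even[OF low_basis_span(2)]
        low_even[OF low_basis_span(5)] u3
      by (auto simp: low_basis_def power2_eq_square power3_eq_cube mult.assoc)
  qed
  have vw: "t Tx2y * t Txy2 \<in> ?even"
  proof -
    have "3 * (t Tx2y * t Txy2) = J33 - t Txy ^ 3 - r" by (simp add: r(2))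
    also have "\<dots> \<in> ?even"
      by (intro span_mod_diff relations_in_span_mod u3 low_even r(1))
    finally show ?thesis by (rule span_mod_cancel_numeral[OF nz3])
  qed
  have v_low: "t Tx2y * q \<in> ?even" if "q \<in> ?low" for q
    using that
  proof (rule span_mod_mult)
    fix g :: "(indet, 'a) polyalg" assume "g \<in> low_basis"
    moreover have "t Tx2y * t Txy ^ 2 = t Txy * (t Txy * t Tx2y :: (indet, 'a) polyalg)"
      by (simp add: power2_eq_square ac_simps)
    ultimately show "t Tx2y * g \<in> ?even"
      using low_even[OF products(1)] low_even[OF products(3)] low_even[OF low_basis_span(3)]
        u_low[OF products(1)] vw
      by (auto simp: low_basis_def mult.commute[of "t Tx2y" "t Txy"])
  qed
  have w_low: "t Txy2 * q \<in> ?even" if "q \<in> ?low" for q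
    using that
  proof (rule span_mod_mult)
    fix g :: "(indet, 'a) polyalg" assume "g \<in> low_basis"
    moreover have "t Txy2 * t Txy ^ 2 = t Txy * (t Txy * t Txy2 :: (indet, 'a) polyalg)"
      by (simp add: power2_eq_square ac_simps)
    ultimately show "t Txy2 * g \<in> ?even"
      using low_even[OF products(2)] low_even[OF products(4)] low_even[OF low_basis_span(4)]
        u_low[OF products(2)] vw
      by (auto simp: low_basis_def mult.commute[of "t Txy2" "t Txy"] mult.commute[of "t Txy2" "t Tx2y"])
  qed
  have u4: "t Txy * t Txy ^ 3 \<in> ?even"
  proof -
    \<comment> \<open>\<open>u\<close> times \<open>J\<^sub>3\<^sub>,\<^sub>3\<close>, with \<open>uvw\<close> read as \<open>w(uv)\<close>\<close>
    have "t Txy * t Txy ^ 3 = t Txy * J33 - 3 * (t Txy2 * (t Txy * t Tx2y)) - t Txy * r"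
      by (simp add: r(2) algebra_simps)
    also have "\<dots> \<in> ?even"
      by (intro span_mod_diff span_mod.scale params_closed w_low u_low products r(1)
          span_mod.ideal[OF ideal_generated_mult[OF ideal_generated_base]])
        (simp add: kernel_generators_def)
    finally show ?thesis .
  qed
  have u: "t Txy * q \<in> ?even" if "q \<in> ?even" for q
    using that
  proof (rule span_mod_mult)
    show "t Txy * g \<in> ?even" if "g \<in> even_basis" for g
      using even_basis_cases[OF that] u4 u_low span_mod.gen by auto
  qed
  show "t Txy * p \<in> ?even" using p by (rule u)
  have "t Tx2y * t Txy ^ 3 = t Txy * (t Txy * (t Txy * t Tx2y :: (indet, 'a) polyalg))"
    "t Txy2 * t Txy ^ 3 = t Txy * (t Txy * (t Txy * t Txy2 :: (indet, 'a) polyalg))"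
    by (simp_all add: power3_eq_cube ac_simps)
  then have "t Tx2y * t Txy ^ 3 \<in> ?even" "t Txy2 * t Txy ^ 3 \<in> ?even"
    by (simp_all add: u u_low products)
  then have "t Tx2y * g \<in> ?even" "t Txy2 * g \<in> ?even" if "g \<in> even_basis" for g
    using even_basis_cases[OF that] v_low w_low span_mod.gen by auto
  then show "t Tx2y * p \<in> ?even" "t Txy2 * p \<in> ?even"
    by (auto intro: span_mod_mult[OF p])
qed

definition full_basis :: "(indet, 'a::field) polyalg set"
  where "full_basis = even_basis \<union> (*) (t S) ` even_basis"

lemma in_span_full_basis:
  assumes nz2: "(2 :: 'a::field) \<noteq> 0" and nz3: "(3 :: 'a) \<noteq> 0"
  shows "(p :: (indet, 'a) polyalg) \<in> span_mod full_basis"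
proof -
  have even_full: "q \<in> span_mod full_basis" "t S * q \<in> span_mod full_basis"
    if "q \<in> span_mod even_basis" for q :: "(indet, 'a) polyalg"
    using that
    by (auto simp: full_basis_def intro: span_mod_mono span_mod_mult span_mod.gen)
  have even_var: "t v * g \<in> span_mod full_basis" "t v * (t S * g) \<in> span_mod full_basis"
    if "v \<in> {Txy, Tx2y, Txy2}" "g \<in> even_basis" for v and g :: "(indet, 'a) polyalg"
  proof -
    have "t v * g \<in> span_mod even_basis"
      using that even_basis_mult[OF nz2 nz3 span_mod.gen[OF that(2)]] by auto
    then show "t v * g \<in> span_mod full_basis" "t v * (t S * g) \<in> span_mod full_basis"
      using even_full by (auto simp: mult.left_commute[of "t v" "t S"])
  qed
  have S: "t S * (t S * g) \<in> span_mod full_basis" if "g \<in> even_basis" for g :: "(indet, 'a) polyalg"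
  proof -
    have "t S * (t S * g) = g * rel_S + (Const (1 / 3) * t Ty3 - Const (1 / 2) * t Ty2 * t Ty + Const (1 / 6) * t Ty ^ 3) * g"
      by (simp add: rel_S_def algebra_simps power2_eq_square)
    also have "\<dots> \<in> span_mod full_basis"
      by (intro span_mod.add span_mod.scale params_closed even_full span_mod.gen that
          span_mod.ideal[OF ideal_generated_mult[OF ideal_generated_base]])
        (simp add: kernel_generators_def)
    finally show ?thesis .
  qed
  show ?thesis
  proof (induction p rule: polyalg_span_induct)
    case one
    show ?case by (intro span_mod.gen) (simp add: full_basis_def even_basis_def low_basis_def)
  next
    case (var v p)
    show ?case
    proof (cases "v \<in> param_vars")
      case True
      then have "t v \<in> params" by (auto simp: param_vars_def params_closed)
      then show ?thesis using var by (rule span_mod.scale)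
    next
      case False
      then have v: "v \<in> {Txy, Tx2y, Txy2, S}" by (cases v) (auto simp: param_vars_def)
      have "t v * g \<in> span_mod full_basis" if "g \<in> full_basis" for g :: "(indet, 'a) polyalg"
      proof -
        from that consider "g \<in> even_basis" | h where "h \<in> even_basis" "g = t S * h"
          by (auto simp: full_basis_def)
        then show ?thesis
        proof cases
          case 1
          then show ?thesis
            using v even_var(1)[of v g] even_full(2)[OF span_mod.gen[of g]] by blast
        next
          case 2
          then show ?thesis
            using v even_var(2)[of v h] S by blast
        qed
      qed
      with var show ?thesis by (rule span_mod_mult)
    qed
  qed (auto intro: span_mod.add span_mod.scale params_closed)
qed

definition normal_form :: "(nat \<Rightarrow> 'r::comm_ring_1) \<Rightarrow> 'r \<Rightarrow> 'r \<Rightarrow> 'r \<Rightarrow> 'r"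
  where "normal_form c u v w = c 0 + c 1 * u + c 2 * v + c 3 * w + c 4 * u ^ 2 + c 5 * u ^ 3"

lemma normal_form_linear:
  "normal_form (\<lambda>i. c i + d i) u v w = normal_form c u v w + normal_form d u v w"
  "normal_form (\<lambda>i. a * c i) u v w = a * normal_form c u v w"
  by (simp_all add: normal_form_def algebra_simps)

lemma normal_form_exists:
  fixes f :: "(indet, 'a::field) polyalg"
  assumes "(2 :: 'a) \<noteq> 0" "(3 :: 'a) \<noteq> 0"
  obtains c d where "\<And>i. c i \<in> params" "\<And>i. d i \<in> params"
    "f - (normal_form c (t Txy) (t Tx2y) (t Txy2) + t S * normal_form d (t Txy) (t Tx2y) (t Txy2))
      \<in> ideal_generated kernel_generators"
proof -
  let ?N = "\<lambda>c. normal_form c (t Txy) (t Tx2y) (t Txy2) :: (indet, 'a) polyalg"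
  let ?I = "ideal_generated kernel_generators :: (indet, 'a) polyalg set"
  have even: "\<exists>c. (\<forall>i. c i \<in> params) \<and> g = ?N c" if "g \<in> even_basis" for g
  proof -
    have "\<exists>k \<le> 5. g = ?N (\<lambda>i. if i = k then 1 else 0)"
      using that by (auto simp: even_basis_def low_basis_def normal_form_def numeral_eq_Suc le_Suc_eq)
    then obtain k where "g = ?N (\<lambda>i. if i = k then 1 else 0)" by blast
    then show ?thesis by (intro exI[of _ "\<lambda>i. if i = k then 1 else 0"]) (simp add: params_closed)
  qed
  have "\<exists>c d. (\<forall>i. c i \<in> params) \<and> (\<forall>i. d i \<in> params) \<and> f - (?N c + t S * ?N d) \<in> ?I"
    using in_span_full_basis[OF assms, of f]
  proof induction
    case (ideal p)
    then show ?case
      by (intro exI[of _ "\<lambda>_. 0"]) (simp add: normal_form_def params_closed)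
  next
    case (gen g)
    have zero: "?N (\<lambda>_. 0) = 0" by (simp add: normal_form_def)
    from gen consider "g \<in> even_basis" | h where "h \<in> even_basis" "g = t S * h"
      by (auto simp: full_basis_def)
    then show ?case
    proof cases
      case 1
      then obtain c where "\<forall>i. c i \<in> params" "g = ?N c" using even by blast
      then show ?thesis
        by (intro exI[of _ c] exI[of _ "\<lambda>_. 0"]) (simp add: zero params_closed ideal_generated_zero)
    next
      case 2
      then obtain d where "\<forall>i. d i \<in> params" "h = ?N d" using even by blast
      with 2 show ?thesis
        by (intro exI[of _ "\<lambda>_. 0"] exI[of _ d]) (simp add: zero params_closed ideal_generated_zero)
    qed
  next
    case (add p q)
    then obtain c d c' d' where
      cd: "\<forall>i. c i \<in> params" "\<forall>i. d i \<in> params" "p - (?N c + t S * ?N d) \<in> ?I" and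
      cd': "\<forall>i. c' i \<in> params" "\<forall>i. d' i \<in> params" "q - (?N c' + t S * ?N d') \<in> ?I"
      by blast
    have eq: "p + q - (?N (\<lambda>i. c i + c' i) + t S * ?N (\<lambda>i. d i + d' i)) =
        (p - (?N c + t S * ?N d)) + (q - (?N c' + t S * ?N d'))"
      by (simp add: normal_form_linear algebra_simps)
    have "p + q - (?N (\<lambda>i. c i + c' i) + t S * ?N (\<lambda>i. d i + d' i)) \<in> ?I"
      unfolding eq by (rule ideal_generated_add[OF cd(3) cd'(3)])
    with cd(1,2) cd'(1,2) show ?case
      by (intro exI[of _ "\<lambda>i. c i + c' i"] exI[of _ "\<lambda>i. d i + d' i"]) (simp add: params_closed)
  next
    case (scale a p)
    then obtain c d where
      cd: "\<forall>i. c i \<in> params" "\<forall>i. d i \<in> params" "p - (?N c + t S * ?N d) \<in> ?I"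
      by blast
    have eq: "a * p - (?N (\<lambda>i. a * c i) + t S * ?N (\<lambda>i. a * d i)) = a * (p - (?N c + t S * ?N d))"
      by (simp add: normal_form_linear algebra_simps)
    have "a * p - (?N (\<lambda>i. a * c i) + t S * ?N (\<lambda>i. a * d i)) \<in> ?I"
      unfolding eq by (rule ideal_generated_mult[OF cd(3)])
    with cd(1,2) scale(1) show ?case
      by (intro exI[of _ "\<lambda>i. a * c i"] exI[of _ "\<lambda>i. a * d i"]) (simp add: params_closed)
  qed
  then show ?thesis using that by blast
qed

section \<open>Independence of the normal form\<close>

text \<open>The value of a normal form at the three points \<open>(X\<^sub>i, Y\<^sub>i)\<close>, when its coefficients have the values
  \<open>c\<close>.\<close>

definition orbit_value :: "(nat \<Rightarrow> 'r::comm_ring_1) \<Rightarrow> 'r \<Rightarrow> 'r \<Rightarrow> 'r \<Rightarrow> 'r \<Rightarrow> 'r \<Rightarrow> 'r \<Rightarrow> 'r"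
  where "orbit_value c X1 X2 X3 Y1 Y2 Y3 = normal_form c (X1 * Y1 + X2 * Y2 + X3 * Y3)
    (X1 ^ 2 * Y1 + X2 ^ 2 * Y2 + X3 ^ 2 * Y3) (X1 * Y1 ^ 2 + X2 * Y2 ^ 2 + X3 * Y3 ^ 2)"

lemma quadratic_three_roots:
  fixes a b c x1 x2 x3 :: "'r::idom"
  assumes "a + b * x1 + c * x1 ^ 2 = 0" "a + b * x2 + c * x2 ^ 2 = 0" "a + b * x3 + c * x3 ^ 2 = 0"
    and "x1 \<noteq> x2" "x1 \<noteq> x3" "x2 \<noteq> x3"
  shows "a = 0" "b = 0" "c = 0"
proof -
  have "(x1 - x2) * (b + c * (x1 + x2)) = 0" "(x1 - x3) * (b + c * (x1 + x3)) = 0"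
    using assms(1-3) by Groebner_Basis.algebra+
  with assms have *: "b + c * (x1 + x2) = 0" "b + c * (x1 + x3) = 0" by simp_all
  then have "(x2 - x3) * c = 0" by Groebner_Basis.algebra
  with assms show c: "c = 0" by simp
  with * show b: "b = 0" by simp
  with c assms show "a = 0" by simp
qed

text \<open>Exchanging \<open>Y\<^sub>2\<close> and \<open>Y\<^sub>3\<close> changes \<open>u\<close>, \<open>v\<close>, \<open>w\<close> by multiples of \<open>(X\<^sub>2 - X\<^sub>3)(Y\<^sub>2 - Y\<^sub>3)\<close>. The quotient is
  symmetric in the indices \<open>2\<close> and \<open>3\<close>, so that it depends only on \<open>X\<^sub>1\<close>, \<open>Y\<^sub>1\<close> and the elementary symmetric
  functions; it is quadratic in \<open>X\<^sub>1\<close>.\<close>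

lemma orbit_value_swap:
  fixes c :: "nat \<Rightarrow> 'r::idom"
  defines "quad \<equiv> \<lambda>e1 e2 f1 f2 x y.
      (c 1 + c 2 * e1 + c 3 * (f1 - y) + c 4 * e1 * (f1 - y)
        + c 5 * ((e1 * (f1 - y)) ^ 2 - (f2 - y * f1 + y ^ 2) * (e1 ^ 2 - 4 * e2) - e2 * (f1 - y) ^ 2))
      + (c 4 * (3 * y - f1) - c 2
        + c 5 * (2 * (3 * y - f1) * (e1 * (f1 - y)) - y * e1 * (f1 - y) - 2 * (f2 - y * f1 + y ^ 2) * e1 + e1 * (f1 - y) ^ 2)) * x
      + c 5 * (9 * y ^ 2 - 6 * f1 * y + 3 * f2) * x ^ 2"
  shows "orbit_value c X1 X2 X3 Y1 Y2 Y3 - orbit_value c X1 X2 X3 Y1 Y3 Y2 =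
    (X2 - X3) * (Y2 - Y3) * quad (X1 + X2 + X3) (X1 * X2 + X1 * X3 + X2 * X3) (Y1 + Y2 + Y3) (Y1 * Y2 + Y1 * Y3 + Y2 * Y3) X1 Y1"
  unfolding orbit_value_def normal_form_def quad_def
  by Groebner_Basis.algebra

text \<open>A simultaneous permutation of the \<open>X\<^sub>i\<close> and the \<open>Y\<^sub>i\<close> renumbers the three points.\<close>

lemma orbit_value_rotate:
  "orbit_value c X1 X2 X3 Y1 Y2 Y3 = orbit_value c X2 X3 X1 Y2 Y3 Y1"
  by (simp add: orbit_value_def ac_simps)

text \<open>The six values form a linear system for the six coefficients, which is to be shown
  nonsingular. By the swapping formula, one polynomial
  in two variables, quadratic in the first, vanishes at all nine pairs \<open>(X\<^sub>i, Y\<^sub>j)\<close>. Hence its coefficients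
  vanish at \<open>Y\<^sub>1\<close>, \<open>Y\<^sub>2\<close>, \<open>Y\<^sub>3\<close>, and they determine the \<open>c\<^sub>i\<close> one after the other, in the
  order \<open>c\<^sub>5\<close>, \<open>c\<^sub>4\<close>, \<open>c\<^sub>2\<close>, \<open>c\<^sub>3\<close>, \<open>c\<^sub>1\<close>, \<open>c\<^sub>0\<close>.\<close>

lemma orbit_value_nonsingular:
  fixes c :: "nat \<Rightarrow> 'r::idom"
  assumes nz: "(3 :: 'r) \<noteq> 0"
    and X: "X1 \<noteq> X2" "X1 \<noteq> X3" "X2 \<noteq> X3" and Y: "Y1 \<noteq> Y2" "Y1 \<noteq> Y3" "Y2 \<noteq> Y3"
    and zero: "orbit_value c X1 X2 X3 Y1 Y2 Y3 = 0" "orbit_value c X1 X2 X3 Y1 Y3 Y2 = 0"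
      "orbit_value c X1 X2 X3 Y2 Y1 Y3 = 0" "orbit_value c X1 X2 X3 Y2 Y3 Y1 = 0"
      "orbit_value c X1 X2 X3 Y3 Y1 Y2 = 0" "orbit_value c X1 X2 X3 Y3 Y2 Y1 = 0"
    and i: "i < 6"
  shows "c i = 0"
proof -
  define e1 e2 f1 f2 where "e1 = X1 + X2 + X3" and "e2 = X1 * X2 + X1 * X3 + X2 * X3"
    and "f1 = Y1 + Y2 + Y3" and "f2 = Y1 * Y2 + Y1 * Y3 + Y2 * Y3"
  define A where "A y = c 1 + c 2 * e1 + c 3 * (f1 - y) + c 4 * e1 * (f1 - y)
        + c 5 * ((e1 * (f1 - y)) ^ 2 - (f2 - y * f1 + y ^ 2) * (e1 ^ 2 - 4 * e2) - e2 * (f1 - y) ^ 2)" for y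
  define B where "B y = c 4 * (3 * y - f1) - c 2
        + c 5 * (2 * (3 * y - f1) * (e1 * (f1 - y)) - y * e1 * (f1 - y) - 2 * (f2 - y * f1 + y ^ 2) * e1 + e1 * (f1 - y) ^ 2)" for y
  define C where "C y = c 5 * (9 * y ^ 2 - 6 * f1 * y + 3 * f2)" for y
  have e: "X1 + X2 + X3 = e1" "X2 + X3 + X1 = e1" "X3 + X1 + X2 = e1"
    "X1 * X2 + X1 * X3 + X2 * X3 = e2" "X2 * X3 + X2 * X1 + X3 * X1 = e2" "X3 * X1 + X3 * X2 + X1 * X2 = e2"
    by (simp_all add: e1_def e2_def ac_simps)
  have f: "Y1 + Y2 + Y3 = f1" "Y2 + Y3 + Y1 = f1" "Y3 + Y1 + Y2 = f1"
    "Y1 * Y2 + Y1 * Y3 + Y2 * Y3 = f2" "Y2 * Y3 + Y2 * Y1 + Y3 * Y1 = f2" "Y3 * Y1 + Y3 * Y2 + Y1 * Y2 = f2"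
    by (simp_all add: f1_def f2_def ac_simps)
  have quad: "A y1 + B y1 * x1 + C y1 * x1 ^ 2 = 0"
    if "x2 \<noteq> x3" "y2 \<noteq> y3" "x1 + x2 + x3 = e1" "x1 * x2 + x1 * x3 + x2 * x3 = e2"
      "y1 + y2 + y3 = f1" "y1 * y2 + y1 * y3 + y2 * y3 = f2"
      "orbit_value c x1 x2 x3 y1 y2 y3 = 0" "orbit_value c x1 x2 x3 y1 y3 y2 = 0" for x1 x2 x3 y1 y2 y3
    using orbit_value_swap[of c x1 x2 x3 y1 y2 y3] that unfolding A_def B_def C_def by simp
  \<comment> \<open>The six values as they appear when \<open>X\<^sub>2\<close> or \<open>X\<^sub>3\<close> takes the first place.\<close>
  have rot: "orbit_value c X2 X3 X1 Y2 Y3 Y1 = 0" "orbit_value c X3 X1 X2 Y3 Y1 Y2 = 0"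
    "orbit_value c X2 X3 X1 Y3 Y2 Y1 = 0" "orbit_value c X3 X1 X2 Y2 Y1 Y3 = 0"
    "orbit_value c X2 X3 X1 Y1 Y3 Y2 = 0" "orbit_value c X3 X1 X2 Y3 Y2 Y1 = 0"
    "orbit_value c X2 X3 X1 Y3 Y1 Y2 = 0" "orbit_value c X3 X1 X2 Y1 Y2 Y3 = 0"
    "orbit_value c X2 X3 X1 Y1 Y2 Y3 = 0" "orbit_value c X3 X1 X2 Y2 Y3 Y1 = 0"
    "orbit_value c X2 X3 X1 Y2 Y1 Y3 = 0" "orbit_value c X3 X1 X2 Y1 Y3 Y2 = 0"
    using zero by (simp_all add: orbit_value_rotate[of c X2 X3 X1] orbit_value_rotate[of c X3 X1 X2])
  note facts = X X[symmetric] Y Y[symmetric] zero rot e f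
  have grid: "A Y1 + B Y1 * X1 + C Y1 * X1 ^ 2 = 0" "A Y1 + B Y1 * X2 + C Y1 * X2 ^ 2 = 0" "A Y1 + B Y1 * X3 + C Y1 * X3 ^ 2 = 0"
    "A Y2 + B Y2 * X1 + C Y2 * X1 ^ 2 = 0" "A Y2 + B Y2 * X2 + C Y2 * X2 ^ 2 = 0" "A Y2 + B Y2 * X3 + C Y2 * X3 ^ 2 = 0"
    "A Y3 + B Y3 * X1 + C Y3 * X1 ^ 2 = 0" "A Y3 + B Y3 * X2 + C Y3 * X2 ^ 2 = 0" "A Y3 + B Y3 * X3 + C Y3 * X3 ^ 2 = 0"
    by (rule quad[of X2 X3 Y2 Y3 X1 Y1] quad[of X3 X1 Y2 Y3 X2 Y1] quad[of X1 X2 Y2 Y3 X3 Y1]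
      quad[of X2 X3 Y3 Y1 X1 Y2] quad[of X3 X1 Y3 Y1 X2 Y2] quad[of X1 X2 Y3 Y1 X3 Y2]
      quad[of X2 X3 Y1 Y2 X1 Y3] quad[of X3 X1 Y1 Y2 X2 Y3] quad[of X1 X2 Y1 Y2 X3 Y3]; rule facts)+
  have ABC: "A y = 0" "B y = 0" "C y = 0" if "y \<in> {Y1, Y2, Y3}" for y
    using that quadratic_three_roots[OF grid(1-3) X] quadratic_three_roots[OF grid(4-6) X]
      quadratic_three_roots[OF grid(7-9) X] by blast+
  have "(3 :: 'r) * 3 \<noteq> 0" using nz by (simp only: mult_eq_0_iff simp_thms)
  then have nz9: "(9 :: 'r) \<noteq> 0" by simp
  have "c 5 * (3 * f2) + c 5 * (- 6 * f1) * y + c 5 * 9 * y ^ 2 = 0" if "y \<in> {Y1, Y2, Y3}" for y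
    using ABC(3)[OF that] unfolding C_def by Groebner_Basis.algebra
  then have "c 5 * 9 = 0"
    using quadratic_three_roots(3)[OF _ _ _ Y] by blast
  with nz9 have c5: "c 5 = 0" by simp
  have B: "c 4 * (3 * Y1 - f1) = c 2" "c 4 * (3 * Y2 - f1) = c 2"
    using ABC(2)[of Y1] ABC(2)[of Y2] by (simp_all add: B_def c5)
  have "3 * (Y1 - Y2) * c 4 = c 4 * (3 * Y1 - f1) - c 4 * (3 * Y2 - f1)" by Groebner_Basis.algebra
  also have "\<dots> = 0" by (simp only: B) simp
  finally have "3 * (Y1 - Y2) * c 4 = 0" .
  with nz Y have c4: "c 4 = 0" by simp
  with B have c2: "c 2 = 0" by simp
  have A: "c 1 + c 3 * (f1 - Y1) = 0" "c 1 + c 3 * (f1 - Y2) = 0"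
    using ABC(1)[of Y1] ABC(1)[of Y2] by (simp_all add: A_def c5 c4 c2)
  have "(Y1 - Y2) * c 3 = (c 1 + c 3 * (f1 - Y2)) - (c 1 + c 3 * (f1 - Y1))" by Groebner_Basis.algebra
  also have "\<dots> = 0" by (simp only: A) simp
  finally have "(Y1 - Y2) * c 3 = 0" .
  with Y have c3: "c 3 = 0" by simp
  with A have c1: "c 1 = 0" by simp
  have "c 0 = 0"
    using zero(1) by (simp add: orbit_value_def normal_form_def c1 c2 c3 c4 c5 del: One_nat_def)
  moreover have "i = 0 \<or> i = 1 \<or> i = 2 \<or> i = 3 \<or> i = 4 \<or> i = 5" using i by auto
  ultimately show ?thesis using c1 c2 c3 c4 c5 by auto
qed

text \<open>By Newton's identities the power sums prescribe a cubic polynomial, and its roots are the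
  solution.\<close>

lemma power_sums_surjective:
  fixes p1 p2 p3 :: "'b::alg_closed_field"
  assumes nz2: "(2 :: 'b) \<noteq> 0" and nz3: "(3 :: 'b) \<noteq> 0"
  obtains X1 X2 X3 where "X1 + X2 + X3 = p1" "X1 ^ 2 + X2 ^ 2 + X3 ^ 2 = p2" "X1 ^ 3 + X2 ^ 3 + X3 ^ 3 = p3"
proof -
  note nz6 = numerals_nonzero(1)[OF nz2 nz3]
  \<comment> \<open>Newton's identities: the elementary symmetric functions in terms of the power sums.\<close>
  define e2 e3 where "e2 = (p1 ^ 2 - p2) / 2" and "e3 = (p1 ^ 3 - 3 * p1 * p2 + 2 * p3) / 6"
  have e2: "2 * e2 = p1 ^ 2 - p2" and e3: "6 * e3 = p1 ^ 3 - 3 * p1 * p2 + 2 * p3"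
    using nz2 nz6 by (simp_all add: e2_def e3_def)
  obtain X1 where X1: "X1 ^ 3 - p1 * X1 ^ 2 + e2 * X1 - e3 = 0"
    using alg_closed_imp_poly_has_root[of "[:- e3, e2, - p1, 1:]"]
    by (auto simp: algebra_simps power2_eq_square power3_eq_cube)
  \<comment> \<open>The cubic divided by \<open>t - X\<^sub>1\<close>.\<close>
  obtain X2 where X2: "X2 ^ 2 + (X1 - p1) * X2 + (X1 ^ 2 - p1 * X1 + e2) = 0"
    using alg_closed_imp_poly_has_root[of "[:X1 ^ 2 - p1 * X1 + e2, X1 - p1, 1:]"]
    by (auto simp: algebra_simps power2_eq_square)
  define X3 where "X3 = p1 - X1 - X2"
  have "X1 + X2 + X3 = p1" by (simp add: X3_def)
  moreover have "X1 ^ 2 + X2 ^ 2 + X3 ^ 2 = p2"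
    using X2 e2 unfolding X3_def by Groebner_Basis.algebra
  moreover have "X1 ^ 3 + X2 ^ 3 + X3 ^ 3 = p3"
  proof -
    have "2 * (X1 ^ 3 + X2 ^ 3 + X3 ^ 3) = 2 * p3"
      using X1 X2 e2 e3 unfolding X3_def by Groebner_Basis.algebra
    then show ?thesis using nz2 by (simp only: mult_cancel_left simp_thms)
  qed
  ultimately show ?thesis by (rule that)
qed

definition regular_power_sums :: "'b::idom \<Rightarrow> 'b \<Rightarrow> 'b \<Rightarrow> bool"
  where "regular_power_sums p1 p2 p3 \<longleftrightarrow> (\<forall>X1 X2 X3.
    X1 + X2 + X3 = p1 \<longrightarrow> X1 ^ 2 + X2 ^ 2 + X3 ^ 2 = p2 \<longrightarrow> X1 ^ 3 + X2 ^ 3 + X3 ^ 3 = p3 \<longrightarrow>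
    X1 \<noteq> X2 \<and> X1 \<noteq> X3 \<and> X2 \<noteq> X3 \<and> X1 * X2 * X3 \<noteq> 0)"

text \<open>If two of the three numbers coincide, with value \<open>r\<close>, the first two power sums give a quadratic
  equation for \<open>r\<close> and the third is determined by \<open>r\<close>. If one of the numbers is zero, the third power sum
  is determined by the other two.\<close>

lemma eventually_regular_power_sums:
  fixes p1 p2 :: "'b::field"
  assumes nz2: "(2 :: 'b) \<noteq> 0" and nz3: "(3 :: 'b) \<noteq> 0"
  shows "\<forall>\<^sub>F p3 in cofinite. regular_power_sums p1 p2 p3"
proof -
  note nz6 = numerals_nonzero(1)[OF nz2 nz3]
  define q where "q = [:p1 ^ 2 - p2, - 4 * p1, 6:]"
  have "q \<noteq> 0" using nz6 by (simp add: q_def)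
  \<comment> \<open>A double root \<open>r\<close> is a root of \<open>q\<close>, the third number being \<open>p\<^sub>1 - 2r\<close>.\<close>
  define bad where "bad = insert (p1 ^ 3 - 3 * p1 * ((p1 ^ 2 - p2) / 2)) ((\<lambda>r. 2 * r ^ 3 + (p1 - 2 * r) ^ 3) ` {r. poly q r = 0})"
  have "finite bad"
    unfolding bad_def using poly_roots_finite[OF \<open>q \<noteq> 0\<close>] by simp
  moreover have "regular_power_sums p1 p2 p3" if "p3 \<notin> bad" for p3
  proof -
    have double: "p3 \<in> bad" if "r + r + s = p1" "r ^ 2 + r ^ 2 + s ^ 2 = p2" "r ^ 3 + r ^ 3 + s ^ 3 = p3" for r s
    proof -
      have s: "s = p1 - 2 * r" by (simp add: that(1)[symmetric] algebra_simps)
      have "poly q r = p1 ^ 2 - p2 - 4 * p1 * r + 6 * r ^ 2"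
        by (simp add: q_def algebra_simps power2_eq_square)
      also have "\<dots> = 0"
        unfolding that(2)[symmetric] s by Groebner_Basis.algebra
      finally have "poly q r = 0" .
      moreover
      have "p3 = 2 * r ^ 3 + (p1 - 2 * r) ^ 3" using that(3) by (simp add: s)
      ultimately show ?thesis by (simp add: bad_def)
    qed
    have zero: "p3 \<in> bad" if "r + s = p1" "r ^ 2 + s ^ 2 = p2" "r ^ 3 + s ^ 3 = p3" for r s
    proof -
      have "(p1 ^ 2 - p2) / 2 = r * s"
        using nz2 that(1,2) by (simp add: field_simps power2_eq_square flip: that(1,2))
      moreover have "p3 = p1 ^ 3 - 3 * p1 * (r * s)"
        unfolding that(1,3)[symmetric] by Groebner_Basis.algebra
      ultimately show ?thesis by (simp add: bad_def)
    qed
    show ?thesis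
      unfolding regular_power_sums_def
    proof (intro allI impI)
      fix X1 X2 X3 assume X: "X1 + X2 + X3 = p1" "X1 ^ 2 + X2 ^ 2 + X3 ^ 2 = p2" "X1 ^ 3 + X2 ^ 3 + X3 ^ 3 = p3"
      show "X1 \<noteq> X2 \<and> X1 \<noteq> X3 \<and> X2 \<noteq> X3 \<and> X1 * X2 * X3 \<noteq> 0"
        using double[of X1 X3] double[of X1 X2] double[of X2 X1] zero[of X1 X2] zero[of X1 X3] zero[of X2 X3] X \<open>p3 \<notin> bad\<close>
        by (auto simp: ac_simps)
    qed
  qed
  ultimately show ?thesis
    unfolding eventually_cofinite by (blast intro: finite_subset)
qed

text \<open>As 2 is invertible, the \<open>x\<^sub>i\<close> and \<open>z\<^sub>i\<close> are coordinates and can be given arbitrary values.\<close>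

lemma geometric_point:
  fixes X1 X2 X3 Z1 Z2 Z3 :: "'a::field alg_closure"
  assumes nz2: "(2 :: 'a alg_closure) \<noteq> 0"
  obtains h where "aeval h x1 = X1" "aeval h x2 = X2" "aeval h x3 = X3"
    "aeval h z1 = Z1" "aeval h z2 = Z2" "aeval h z3 = Z3"
proof -
  have rep: "Rep_edge (Abs_edge {i, j}) = {i, j}" if "i \<in> {1..4}" "j \<in> {1..4}" "i \<noteq> j" for i j
    using that by (intro Abs_edge_inverse) auto
  define h where "h e = (let E = Rep_edge e in
      if E = {1, 2} then (X1 + Z1) / 2 else if E = {3, 4} then (X1 - Z1) / 2
      else if E = {1, 3} then (X2 + Z2) / 2 else if E = {2, 4} then (X2 - Z2) / 2
      else if E = {1, 4} then (X3 + Z3) / 2 else (X3 - Z3) / 2)" for e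
  have h: "h (Abs_edge {1, 2}) = (X1 + Z1) / 2" "h (Abs_edge {3, 4}) = (X1 - Z1) / 2"
    "h (Abs_edge {1, 3}) = (X2 + Z2) / 2" "h (Abs_edge {2, 4}) = (X2 - Z2) / 2"
    "h (Abs_edge {1, 4}) = (X3 + Z3) / 2" "h (Abs_edge {2, 3}) = (X3 - Z3) / 2"
    by (simp_all add: h_def Let_def rep doubleton_eq_iff del: One_nat_def)
  have "(p + q) / 2 + (p - q) / 2 = p" "(p + q) / 2 - (p - q) / 2 = q" for p q :: "'a alg_closure"
    using nz2 by (simp_all add: add_divide_distrib[symmetric] diff_divide_distrib[symmetric])
  then show ?thesis
    by (intro that[of h]) (simp_all only: xz_defs xe_def aeval_add aeval_diff aeval_Var h)
qed

text \<open>A point of the parameter space with regular power sums lifts to points \<open>(X, Z)\<close>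
  with \<open>Z\<^sub>i\<^sup>2 = Y\<^sub>i\<close>. Changing the sign of \<open>Z\<^sub>1\<close> separates the two halves of the normal form,
  since \<open>z\<^sub>1z\<^sub>2z\<^sub>3\<close> changes its sign and nothing else changes; permuting the \<open>Y\<^sub>i\<close> separates the
  six coefficients in each half.\<close>

lemma normal_form_kernel_trivial:
  fixes c d :: "nat \<Rightarrow> (indet, 'a::field) polyalg"
  assumes nz2: "(2 :: 'a) \<noteq> 0" and nz3: "(3 :: 'a) \<noteq> 0"
    and c: "\<And>i. c i \<in> params" and d: "\<And>i. d i \<in> params"
    and kernel: "phi (normal_form c (t Txy) (t Tx2y) (t Txy2) + t S * normal_form d (t Txy) (t Tx2y) (t Txy2)) = 0"
    and i: "i < 6"
  shows "c i = 0" "d i = 0"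
proof -
  have nz: "(2 :: 'a alg_closure) \<noteq> 0" "(3 :: 'a alg_closure) \<noteq> 0"
    by (rule alg_closure_numeral_nonzero[OF nz2] alg_closure_numeral_nonzero[OF nz3])+
  have vanish: "aeval g (c i) = 0 \<and> aeval g (d i) = 0"
    if reg: "regular_power_sums (g Tx) (g Tx2) (g Tx3)" "regular_power_sums (g Ty) (g Ty2) (g Ty3)" for g
  proof -
    let ?c = "\<lambda>i. aeval g (c i)" and ?d = "\<lambda>i. aeval g (d i)"
    obtain X1 X2 X3 where X: "X1 + X2 + X3 = g Tx" "X1 ^ 2 + X2 ^ 2 + X3 ^ 2 = g Tx2" "X1 ^ 3 + X2 ^ 3 + X3 ^ 3 = g Tx3"
      by (rule power_sums_surjective[OF nz])
    obtain Y1 Y2 Y3 where Y: "Y1 + Y2 + Y3 = g Ty" "Y1 ^ 2 + Y2 ^ 2 + Y3 ^ 2 = g Ty2" "Y1 ^ 3 + Y2 ^ 3 + Y3 ^ 3 = g Ty3"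
      by (rule power_sums_surjective[OF nz])
    have X_dist: "X1 \<noteq> X2" "X1 \<noteq> X3" "X2 \<noteq> X3"
      using reg(1) X unfolding regular_power_sums_def by blast+
    have Y_dist: "Y1 \<noteq> Y2" "Y1 \<noteq> Y3" "Y2 \<noteq> Y3" and Y_nz: "Y1 * Y2 * Y3 \<noteq> 0"
      using reg(2) Y unfolding regular_power_sums_def by blast+
    have eval: "orbit_value ?c X1 X2 X3 (w1 ^ 2) (w2 ^ 2) (w3 ^ 2) + w1 * w2 * w3 * orbit_value ?d X1 X2 X3 (w1 ^ 2) (w2 ^ 2) (w3 ^ 2) = 0"
      if w: "w1 ^ 2 + w2 ^ 2 + w3 ^ 2 = g Ty" "(w1 ^ 2) ^ 2 + (w2 ^ 2) ^ 2 + (w3 ^ 2) ^ 2 = g Ty2"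
        "(w1 ^ 2) ^ 3 + (w2 ^ 2) ^ 3 + (w3 ^ 2) ^ 3 = g Ty3" for w1 w2 w3
    proof -
      obtain h where h: "aeval h x1 = X1" "aeval h x2 = X2" "aeval h x3 = X3"
        "aeval h z1 = w1" "aeval h z2 = w2" "aeval h z3 = w3"
        by (rule geometric_point[OF nz(1)])
      define k where "k = (\<lambda>v. aeval h (phi_indet v))"
      have k: "k Txy = X1 * w1 ^ 2 + X2 * w2 ^ 2 + X3 * w3 ^ 2" "k Tx2y = X1 ^ 2 * w1 ^ 2 + X2 ^ 2 * w2 ^ 2 + X3 ^ 2 * w3 ^ 2"
        "k Txy2 = X1 * (w1 ^ 2) ^ 2 + X2 * (w2 ^ 2) ^ 2 + X3 * (w3 ^ 2) ^ 2" "k S = w1 * w2 * w3"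
        by (simp_all add: k_def br_def h flip: power_mult)
      have "k v = g v" if "v \<in> param_vars" for v
        using that X w by (auto simp: param_vars_def k_def br_def h simp flip: power_mult)
      then have param: "aeval k p = aeval g p" if "p \<in> params" for p
        using that by (intro aeval_cong) (auto simp: params_def)
      have "0 = aeval h (phi (normal_form c (t Txy) (t Tx2y) (t Txy2) + t S * normal_form d (t Txy) (t Tx2y) (t Txy2)))"
        by (simp add: kernel)
      also have "\<dots> = aeval k (normal_form c (t Txy) (t Tx2y) (t Txy2) + t S * normal_form d (t Txy) (t Tx2y) (t Txy2))"
        by (simp only: phi_def aeval_subst k_def)
      also have "\<dots> = normal_form ?c (k Txy) (k Tx2y) (k Txy2) + k S * normal_form ?d (k Txy) (k Tx2y) (k Txy2)"
        by (simp add: normal_form_def param c d)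
      finally show ?thesis by (simp only: k orbit_value_def)
    qed
    have orbit: "orbit_value ?c X1 X2 X3 y1 y2 y3 = 0 \<and> orbit_value ?d X1 X2 X3 y1 y2 y3 = 0"
      if y: "y1 + y2 + y3 = g Ty" "y1 ^ 2 + y2 ^ 2 + y3 ^ 2 = g Ty2" "y1 ^ 3 + y2 ^ 3 + y3 ^ 3 = g Ty3"
        and y_nz: "y1 * y2 * y3 \<noteq> 0" for y1 y2 y3
    proof -
      obtain w1 w2 w3 where w: "w1 ^ 2 = y1" "w2 ^ 2 = y2" "w3 ^ 2 = y3"
        using nth_root_exists[of 2 y1] nth_root_exists[of 2 y2] nth_root_exists[of 2 y3] by auto
      define s where "s = w1 * w2 * w3"
      have s_nz: "s \<noteq> 0" using y_nz w by (auto simp: s_def)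
      let ?C = "orbit_value ?c X1 X2 X3 y1 y2 y3" and ?D = "orbit_value ?d X1 X2 X3 y1 y2 y3"
      have plus: "?C + s * ?D = 0" and minus: "?C - s * ?D = 0"
        using eval[of w1 w2 w3] eval[of "- w1" w2 w3] y w by (simp_all add: s_def)
      have "2 * ?C = (?C + s * ?D) + (?C - s * ?D)" by simp
      then have "2 * ?C = 0" by (simp only: plus minus) simp
      with nz have C: "?C = 0" by simp
      with plus s_nz show ?thesis by simp
    qed
    have six: "orbit_value ?c X1 X2 X3 Y1 Y2 Y3 = 0 \<and> orbit_value ?d X1 X2 X3 Y1 Y2 Y3 = 0"
      "orbit_value ?c X1 X2 X3 Y1 Y3 Y2 = 0 \<and> orbit_value ?d X1 X2 X3 Y1 Y3 Y2 = 0"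
      "orbit_value ?c X1 X2 X3 Y2 Y1 Y3 = 0 \<and> orbit_value ?d X1 X2 X3 Y2 Y1 Y3 = 0"
      "orbit_value ?c X1 X2 X3 Y2 Y3 Y1 = 0 \<and> orbit_value ?d X1 X2 X3 Y2 Y3 Y1 = 0"
      "orbit_value ?c X1 X2 X3 Y3 Y1 Y2 = 0 \<and> orbit_value ?d X1 X2 X3 Y3 Y1 Y2 = 0"
      "orbit_value ?c X1 X2 X3 Y3 Y2 Y1 = 0 \<and> orbit_value ?d X1 X2 X3 Y3 Y2 Y1 = 0"
      by (rule orbit; use Y_nz in \<open>simp add: Y[symmetric] ac_simps\<close>)+
    show ?thesis
      using orbit_value_nonsingular[OF nz(2) X_dist Y_dist, of ?c, OF _ _ _ _ _ _ i]
        orbit_value_nonsingular[OF nz(2) X_dist Y_dist, of ?d, OF _ _ _ _ _ _ i] six by blast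
  qed
  have zero: "e = 0" if e: "e \<in> params"
    "\<And>g. regular_power_sums (g Tx) (g Tx2) (g Tx3) \<Longrightarrow> regular_power_sums (g Ty) (g Ty2) (g Ty3) \<Longrightarrow> aeval g e = 0"
    for e :: "(indet, 'a) polyalg"
  proof (rule ccontr)
    assume "e \<noteq> 0"
    have regular: "eventually (regular_power_sums p1 p2) cofinite" for p1 p2 :: "'a alg_closure"
      using eventually_regular_power_sums[OF nz, of p1 p2] by simp
    \<comment> \<open>The indeterminates of the third power sums come first: their exceptional values depend on
      those of the first two power sums.\<close>
    let ?vs = "[Tx3, Ty3, Tx, Tx2, Ty, Ty2]"
    have "generic ?vs (\<lambda>g. aeval g e \<noteq> 0) (\<lambda>_. 0)"
      using e(1) by (intro generic_nonzero \<open>e \<noteq> 0\<close>) (auto simp: params_def param_vars_def)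
    moreover have "generic ?vs (\<lambda>g. regular_power_sums (g Tx) (g Tx2) (g Tx3)) (\<lambda>_. 0 :: 'a alg_closure)"
      by (simp add: regular)
    moreover have "generic ?vs (\<lambda>g. regular_power_sums (g Ty) (g Ty2) (g Ty3)) (\<lambda>_. 0 :: 'a alg_closure)"
      by (simp add: regular)
    ultimately have "generic ?vs (\<lambda>g. aeval g e \<noteq> 0 \<and> regular_power_sums (g Tx) (g Tx2) (g Tx3)
        \<and> regular_power_sums (g Ty) (g Ty2) (g Ty3)) (\<lambda>_. 0)"
      by (intro generic_conj)
    from generic_ex[OF infinite_alg_closed this] e(2) show False by blast
  qed
  show "c i = 0" "d i = 0"
    using zero[OF c, of i] zero[OF d, of i] vanish by blast+
qed

section \<open>The kernel and its minimal generators\<close>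

text \<open>These are polynomial identities in the \<open>x\<^sub>i\<close> and the \<open>y\<^sub>i = z\<^sub>i\<^sup>2\<close>; the relation for \<open>S\<^sup>2\<close> is Newton's
  formula for \<open>y\<^sub>1y\<^sub>2y\<^sub>3\<close>.\<close>

lemma phi_relations:
  assumes nz2: "(2 :: 'a::field) \<noteq> 0" and nz3: "(3 :: 'a) \<noteq> 0"
    and r: "r \<in> kernel_generators"
  shows "phi r = (0 :: (edge, 'a) polyalg)"
proof (rule polyalg_eqI_aeval)
  fix h :: "edge \<Rightarrow> 'a alg_closure"
  have nz: "(2 :: 'a alg_closure) \<noteq> 0" "(3 :: 'a alg_closure) \<noteq> 0"
    by (rule alg_closure_numeral_nonzero[OF nz2] alg_closure_numeral_nonzero[OF nz3])+
  note nz6 = numerals_nonzero(1)[OF nz]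
  obtain X1 X2 X3 Y1 Y2 Y3 Z1 Z2 Z3 where
    XZ: "aeval h x1 = X1" "aeval h x2 = X2" "aeval h x3 = X3" "aeval h z1 = Z1" "aeval h z2 = Z2" "aeval h z3 = Z3"
    and Y: "Y1 = Z1 ^ 2" "Y2 = Z2 ^ 2" "Y3 = Z3 ^ 2" by blast
  define k where "k = (\<lambda>v. aeval h (phi_indet v))"
  have k: "k Tx = X1 + X2 + X3" "k Tx2 = X1 ^ 2 + X2 ^ 2 + X3 ^ 2" "k Tx3 = X1 ^ 3 + X2 ^ 3 + X3 ^ 3"
    "k Ty = Y1 + Y2 + Y3" "k Ty2 = Y1 ^ 2 + Y2 ^ 2 + Y3 ^ 2" "k Ty3 = Y1 ^ 3 + Y2 ^ 3 + Y3 ^ 3"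
    "k Txy = X1 * Y1 + X2 * Y2 + X3 * Y3" "k Tx2y = X1 ^ 2 * Y1 + X2 ^ 2 * Y2 + X3 ^ 2 * Y3"
    "k Txy2 = X1 * Y1 ^ 2 + X2 * Y2 ^ 2 + X3 * Y3 ^ 2"
    by (simp_all add: k_def br_def XZ Y flip: power_mult)
  have kS: "k S ^ 2 = Y1 * Y2 * Y3"
    by (simp add: k_def XZ Y power_mult_distrib)
  have "aeval k J32 = 0" "aeval k J23 = 0"
    by (simp_all only: J32_def J23_def aeval_add aeval_diff aeval_mult aeval_power aeval_numeral aeval_Var k)
      (Groebner_Basis.algebra+)
  moreover have "aeval k J42 = 0" "aeval k J24 = 0"
    by (simp_all only: J42_def J24_def aeval_add aeval_diff aeval_mult aeval_power aeval_numeral aeval_Var k)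
      (Groebner_Basis.algebra+)
  moreover have "aeval k J33 = 0"
    by (simp only: J33_def aeval_add aeval_diff aeval_mult aeval_power aeval_numeral aeval_Var k)
      Groebner_Basis.algebra
  moreover have "aeval k rel_S = 0"
  proof -
    obtain a b d :: "'a alg_closure" where abd: "1 / 2 = a" "1 / 3 = b" "1 / 6 = d" by blast
    then have "2 * a = 1" "3 * b = 1" "6 * d = 1" using nz nz6 by (auto simp: mult.commute)
    then have "6 * aeval k rel_S = 6 * k S ^ 2 - 2 * k Ty3 + 3 * k Ty2 * k Ty - k Ty ^ 3"
      unfolding rel_S_def aeval_add aeval_diff aeval_mult aeval_power aeval_Const aeval_Var
        to_ac_divide to_ac_1 to_ac_numeral abd by Groebner_Basis.algebra
    also have "\<dots> = 0"
      unfolding kS k by Groebner_Basis.algebra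
    finally show ?thesis using nz6 by simp
  qed
  ultimately have "aeval k r = 0"
    using r by (auto simp: kernel_generators_def)
  then show "aeval h (phi r) = aeval h 0"
    by (simp add: phi_def aeval_subst k_def)
qed

lemma ideal_generated_kernel:
  assumes nz2: "(2 :: 'a::field) \<noteq> 0" and nz3: "(3 :: 'a) \<noteq> 0"
  shows "ideal_generated kernel_generators = {f :: (indet, 'a) polyalg. phi f = 0}"
proof
  show sub: "ideal_generated kernel_generators \<subseteq> {f :: (indet, 'a) polyalg. phi f = 0}"
    by (rule ideal_generated_minimal)
      (auto simp: phi_relations[OF nz2 nz3], auto simp: phi_def subst_add subst_mult)
  show "{f :: (indet, 'a) polyalg. phi f = 0} \<subseteq> ideal_generated kernel_generators"
  proof
    fix f :: "(indet, 'a) polyalg" assume "f \<in> {f. phi f = 0}"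
    then have f: "phi f = 0" by simp
    obtain c d where cd: "\<And>i. c i \<in> params" "\<And>i. d i \<in> params"
      and nf: "f - (normal_form c (t Txy) (t Tx2y) (t Txy2) + t S * normal_form d (t Txy) (t Tx2y) (t Txy2))
        \<in> ideal_generated kernel_generators" (is "f - ?N \<in> _")
      by (rule normal_form_exists[OF nz2 nz3, of f]) (rule that)
    have "phi (f - ?N) = 0" using nf sub by blast
    then have "phi ?N = 0" using f by (simp add: phi_def subst_diff)
    then have "c i = 0" "d i = 0" if "i < 6" for i
      by (rule normal_form_kernel_trivial[OF nz2 nz3 cd _ that])+
    then have "?N = 0" by (simp add: normal_form_def)
    with nf show "f \<in> ideal_generated kernel_generators" by simp
  qed
qed

text \<open>Evaluation at a point is multiplicative, so the polynomials that vanish at it form an ideal.\<close>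

lemma separated_generator:
  assumes "aeval g b \<noteq> 0" "\<And>r. r \<in> C \<Longrightarrow> aeval g r = 0"
  shows "b \<notin> ideal_generated C"
proof -
  have "ideal_generated C \<subseteq> {p. aeval g p = 0}"
    by (rule ideal_generated_minimal) (use assms(2) in auto)
  with assms(1) show ?thesis by blast
qed

text \<open>The point is supported on the indeterminates of one monomial of the generator, for instance
  of \<open>v\<^sup>2\<close> in \<open>J\<^sub>4\<^sub>,\<^sub>2\<close>, chosen such that the other relations have no monomial in these indeterminates alone.
  For \<open>J\<^sub>2\<^sub>,\<^sub>3\<close> the point has in addition a value of \<open>S\<close>, at which the relation for \<open>S\<^sup>2\<close> vanishes.\<close>

lemma kernel_generators_independent:
  assumes nz2: "(2 :: 'a::field) \<noteq> 0" and nz3: "(3 :: 'a) \<noteq> 0"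
    and b: "b \<in> (kernel_generators :: (indet, 'a) polyalg set)"
  shows "b \<notin> ideal_generated (kernel_generators - {b})"
proof -
  have nz: "(2 :: 'a alg_closure) \<noteq> 0" "(3 :: 'a alg_closure) \<noteq> 0"
    by (rule alg_closure_numeral_nonzero[OF nz2] alg_closure_numeral_nonzero[OF nz3])+
  note nz6 = numerals_nonzero(1,2)[OF nz]
  note defs = rel_S_def J32_def J23_def J42_def J33_def J24_def
  have "\<exists>g. aeval g b \<noteq> 0 \<and> (\<forall>r \<in> kernel_generators - {b}. aeval g r = 0)"
  proof -
    from b consider "b = rel_S" | "b = J32" | "b = J23" | "b = J42" | "b = J33" | "b = J24"
      by (auto simp: kernel_generators_def)
    then show ?thesis
    proof cases
      case 1
      then show ?thesis
        by (intro exI[of _ "\<lambda>v. if v = S then 1 else 0"]) (auto simp: kernel_generators_def, simp_all add: defs)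
    next
      case 2
      then show ?thesis using nz
        by (intro exI[of _ "\<lambda>v. if v = Tx3 \<or> v = Ty2 then 1 else 0"]) (auto simp: kernel_generators_def, simp_all add: defs)
    next
      case 3
      \<comment> \<open>For \<open>T\<^sub>y = 0\<close> the relation for \<open>S\<^sup>2\<close> says that \<open>S\<^sup>2\<close> is a third of the value of \<open>Ty3\<close>, here \<open>3\<close>.\<close>
      then show ?thesis using nz nz6
        by (intro exI[of _ "\<lambda>v. if v = S \<or> v = Tx2 then 1 else if v = Ty3 then 3 else 0"])
          (auto simp: kernel_generators_def, simp_all add: defs)
    next
      case 4
      then show ?thesis using nz6
        by (intro exI[of _ "\<lambda>v. if v = Tx2y then 1 else 0"]) (auto simp: kernel_generators_def, simp_all add: defs)
    next
      case 5
      then show ?thesis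
        by (intro exI[of _ "\<lambda>v. if v = Txy then 1 else 0"]) (auto simp: kernel_generators_def, simp_all add: defs)
    next
      case 6
      then show ?thesis using nz6
        by (intro exI[of _ "\<lambda>v. if v = Txy2 then 1 else 0"]) (auto simp: kernel_generators_def, simp_all add: defs)
    qed
  qed
  then show ?thesis using separated_generator by blast
qed

theorem theorem2:
  assumes "CHAR('a::field) = 0 \<or> CHAR('a) > 4"
  shows "alg_generated
      {br 1 0, br 2 0, br 3 0, br 0 2, br 0 4, br 0 6, br 1 2, br 2 2, br 1 4, z1 * z2 * z3}
      = (S4_invariants :: (edge, 'a) polyalg set)
    \<and> range (phi :: (indet, 'a) polyalg \<Rightarrow> (edge, 'a) polyalg) = S4_invariants
    \<and> minimally_generated_ideal {f :: (indet, 'a) polyalg. phi f = 0}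
        {rel_S, J32, J23, J42, J33, J24}"
proof -
  have "\<not> CHAR('a) dvd n" if "0 < n" "n < 4" for n
  proof
    assume "CHAR('a) dvd n"
    with that have "CHAR('a) \<noteq> 0" "CHAR('a) \<le> n" by (auto intro: dvd_imp_le)
    with assms that show False by simp
  qed
  then have nz: "(of_nat n :: 'a) \<noteq> 0" if "0 < n" "n < 4" for n
    using that by (simp add: of_nat_eq_0_iff_char_dvd)
  have nz2: "(2 :: 'a) \<noteq> 0" and nz3: "(3 :: 'a) \<noteq> 0"
    using nz[of 2] nz[of 3] by simp_all
  let ?I = "S4_invariants :: (edge, 'a) polyalg set"
  have "range (phi :: (indet, 'a) polyalg \<Rightarrow> _) \<subseteq> alg_generated invariant_generators"
    "alg_generated invariant_generators \<subseteq> ?I" "?I \<subseteq> range (phi :: (indet, 'a) polyalg \<Rightarrow> _)"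
    by (rule range_phi_subset_alg_generated alg_generated_subset_invariants invariants_subset_range_phi[OF nz2 nz3])+
  then have "alg_generated invariant_generators = ?I" "range (phi :: (indet, 'a) polyalg \<Rightarrow> _) = ?I"
    by blast+
  moreover have "minimally_generated_ideal {f :: (indet, 'a) polyalg. phi f = 0} kernel_generators"
    unfolding minimally_generated_ideal_def
  proof (intro conjI allI impI)
    show "ideal_generated kernel_generators = {f :: (indet, 'a) polyalg. phi f = 0}"
      by (rule ideal_generated_kernel[OF nz2 nz3])
    fix C :: "(indet, 'a) polyalg set" assume "C \<subset> kernel_generators"
    then obtain b where b: "b \<in> kernel_generators" "C \<subseteq> kernel_generators - {b}" by blast
    have "ideal_generated C \<subseteq> ideal_generated (kernel_generators - {b})"
      using b(2) by (intro ideal_generated_minimal ideal_generated_zero ideal_generated_add ideal_generated_mult)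
        (auto intro: ideal_generated_base)
    then have "b \<notin> ideal_generated C"
      using kernel_generators_independent[OF nz2 nz3 b(1)] by blast
    moreover have "b \<in> {f. phi f = 0}"
      using phi_relations[OF nz2 nz3 b(1)] by simp
    ultimately show "ideal_generated C \<noteq> {f. phi f = 0}" by blast
  qed
  ultimately show ?thesis
    unfolding invariant_generators_def kernel_generators_def by blast
qed

end
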